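(* Let $H=([n],[m],E)$ be a bigraph and $\vec p\in(0,\infty)^n$. The following three conditions are equivalent: (1) for every $\lambda>0$ with $\lambda\vec p\in\mathcal I(H)$, there is an exclusive cylinder family $\mathcal A\sim H$ with $\mu(\mathcal A)=\lambda\vec p$; (2) for the $\lambda>0$ with $\lambda\vec p\in\partial(H)$, there is an exclusive cylinder family $\mathcal A\sim H$ with $\mu(\mathcal A)=\lambda\vec p$; (3) $H$ is gapless in the direction of $\vec p$.
   Context: A bigraph $H=([n],[m],E)$ has left part $[n]$, right part $[m]$, edges $E\subseteq[n]\times[m]$, neighborhoods $\mathcal N_H(\cdot)$; its base graph $G_H$ is the graph on $[n]$ where distinct $u,v$ are adjacent iff they share a neighbor in $H$. Equip $[0,1]^m$ with Lebesgue measure $\mu$. A family $\mathcal A=\{A_1,\dots,A_n\}$ of measurable subsets of $[0,1]^m$ conforms with $H$ ($\mathcal A\sim H$) if each $A_i=B_i\times[0,1]^{[m]\setminus\mathcal N_H(i)}$ with $B_i\subseteq[0,1]^{\mathcal N_H(i)}$ measurable; $\mu(\mathcal A)=(\mu(A_i))_i$. Such $\mathcal A$ is exclusive (w.r.t. $H$) if $\mu(A_i\cap A_j)=0$ whenever $i\neq j$ are adjacent in $G_H$. The interior $\mathcal I(H)$ is the set of $\vec p\in(0,1)^n$ with $\mu(\bigcap_i([0,1]^m\setminus A_i))>0$ for all $\mathcal A\sim H$ with $\mu(\mathcal A)=\vec p$; the boundary $\partial(H)$ is the set of $\vec p\in(0,1]^n$ such that $(1-\epsilon)\vec p\in\mathcal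 I(H)$ and $(1+\epsilon)\vec p\notin\mathcal I(H)$ for all $\epsilon\in(0,1)$ (for each $\vec p$ there is a unique $\lambda>0$ with $\lambda\vec p\in\partial(H)$). For a graph $G$ on $[n]$, the abstract interior $\mathcal I_a(G)$ is the set of $\vec p\in(0,1)^n$ such that for every probability space and events $A_1,\dots,A_n$ with $\Pr(A_i)=p_i$ for which $G$ is a dependency graph (each $A_i$ is mutually independent of $\{A_j: j\ne i,\ j\notin\mathcal N_G(i)\}$), $\Pr(\bigcap_i\overline{A_i})>0$. $H$ is gapless in the direction of $\vec p$ if for every $\lambda>0$, $\lambda\vec p\in\mathcal I(H)$ iff $\lambda\vec p\in\mathcal I_a(G_H)$.
   Formalization: The formal theorem additionally assumes that the base graph G_H is connected and that every left vertex of H has a neighbor; without these the equivalence fails (e.g. a 4-cycle bigraph plus an isolated event with p=(.28,.28,.28,.28,1), or n=1 with no edges). *)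

theory Defs
  imports "HOL-Probability.Probability"
begin

text \<open>
  A bigraph with left part \<open>'n\<close> and right part \<open>'m\<close> (nonempty finite types standing for
  \<open>[n]\<close> and \<open>[m]\<close>) is given by its edge set \<open>E :: ('n \<times> 'm) set\<close>. A graph on \<open>'n\<close> is given
  by its adjacency relation.
\<close>

definition nbhd :: "('n \<times> 'm) set \<Rightarrow> 'n \<Rightarrow> 'm set" where
  "nbhd E i = {j. (i, j) \<in> E}"

definition base_graph :: "('n \<times> 'm) set \<Rightarrow> ('n \<times> 'n) set" where
  "base_graph E = {(u, v). u \<noteq> v \<and> nbhd E u \<inter> nbhd E v \<noteq> {}}"

definition graph_connected :: "('n \<times> 'n) set \<Rightarrow> bool" where
  "graph_connected G \<longleftrightarrow> (\<forall>u v. (u, v) \<in> G\<^sup>*)"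

text \<open>
  \<open>cube J\<close> is \<open>[0,1]\<^sup>J\<close> with Lebesgue measure: the completion makes the measurable sets
  the Lebesgue measurable ones rather than only the Borel ones. For \<open>J = {}\<close> it is a one-point
  probability space.
\<close>

definition unit_interval :: "real measure" where
  "unit_interval = restrict_space lborel {0..1}"

definition cube :: "'m set \<Rightarrow> ('m \<Rightarrow> real) measure" where
  "cube J = completion (Pi\<^sub>M J (\<lambda>_. unit_interval))"

text \<open>
  \<open>prod_emb UNIV M J B\<close> is the cylinder \<open>B \<times> [0,1]\<^bsup>UNIV - J\<^esup>\<close>, i.e.\ the points of the full cube
  whose restriction to \<open>J\<close> lies in \<open>B\<close>.
\<close>

definition conforms :: "('n \<times> 'm) set \<Rightarrow> ('n \<Rightarrow> ('m \<Rightarrow> real) set) \<Rightarrow> bool" where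
  "conforms E A \<longleftrightarrow>
     (\<forall>i. \<exists>B \<in> sets (cube (nbhd E i)). A i = prod_emb UNIV (\<lambda>_. unit_interval) (nbhd E i) B)"

definition measure_vec :: "('n::finite \<Rightarrow> ('m \<Rightarrow> real) set) \<Rightarrow> real ^ 'n" where
  "measure_vec A = (\<chi> i. measure (cube UNIV) (A i))"

definition exclusive :: "('n \<times> 'm) set \<Rightarrow> ('n \<Rightarrow> ('m \<Rightarrow> real) set) \<Rightarrow> bool" where
  "exclusive E A \<longleftrightarrow> (\<forall>(i, j) \<in> base_graph E. measure (cube UNIV) (A i \<inter> A j) = 0)"

definition has_exclusive_family :: "('n::finite \<times> 'm) set \<Rightarrow> real ^ 'n \<Rightarrow> bool" where
  "has_exclusive_family E p \<longleftrightarrow> (\<exists>A. conforms E A \<and> exclusive E A \<and> measure_vec A = p)"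

definition bigraph_interior :: "('n::finite \<times> 'm) set \<Rightarrow> (real ^ 'n) set" where
  "bigraph_interior E =
     {p. (\<forall>i. 0 < p $ i \<and> p $ i < 1) \<and>
         (\<forall>A. conforms E A \<and> measure_vec A = p \<longrightarrow>
              measure (cube UNIV) (\<Inter>i. space (cube UNIV) - A i) > 0)}"

definition bigraph_boundary :: "('n::finite \<times> 'm) set \<Rightarrow> (real ^ 'n) set" where
  "bigraph_boundary E =
     {p. (\<forall>i. 0 < p $ i \<and> p $ i \<le> 1) \<and>
         (\<forall>\<epsilon>. 0 < \<epsilon> \<and> \<epsilon> < 1 \<longrightarrow>
              (1 - \<epsilon>) *\<^sub>R p \<in> bigraph_interior E \<and> (1 + \<epsilon>) *\<^sub>R p \<notin> bigraph_interior E)}"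

text \<open>
  Mutual independence of \<open>A i\<close> from a family of events means independence from the
  \<open>\<sigma>\<close>-algebra generated by the family, not merely pairwise independence.
\<close>

definition dependency_graph :: "'a measure \<Rightarrow> ('n \<times> 'n) set \<Rightarrow> ('n \<Rightarrow> 'a set) \<Rightarrow> bool" where
  "dependency_graph M G A \<longleftrightarrow>
     (\<forall>i. prob_space.indep_set M {A i}
            (sigma_sets (space M) (A ` {j. j \<noteq> i \<and> (i, j) \<notin> G})))"

text \<open>
  A definition cannot quantify over all types, so the probability spaces below have \<open>real\<close> as
  underlying type (with arbitrary \<open>\<sigma>\<close>-algebra and measure). This loses no generality: the lemma
  \<open>abstract_interiorD\<close> gives the defining property for probability spaces over any type.
\<close>

definition abstract_interior :: "('n::finite \<times> 'n) set \<Rightarrow> (real ^ 'n) set" where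
  "abstract_interior G =
     {p. (\<forall>i. 0 < p $ i \<and> p $ i < 1) \<and>
         (\<forall>(M :: real measure) A.
              prob_space M \<and> (\<forall>i. A i \<in> sets M) \<and> (\<forall>i. measure M (A i) = p $ i) \<and>
              dependency_graph M G A \<longrightarrow>
              measure M (\<Inter>i. space M - A i) > 0)}"

definition gapless_in_direction :: "('n::finite \<times> 'm) set \<Rightarrow> real ^ 'n \<Rightarrow> bool" where
  "gapless_in_direction E p \<longleftrightarrow>
     (\<forall>l>0. l *\<^sub>R p \<in> bigraph_interior E \<longleftrightarrow> l *\<^sub>R p \<in> abstract_interior (base_graph E))"

lemma abstract_interiorD:
  fixes M :: "'b measure" and p :: "real ^ 'n::finite"
  assumes p: "p \<in> abstract_interior G" and M: "prob_space M"
    and A: "\<And>i. A i \<in> sets M" and Ap: "\<And>i. measure M (A i) = p $ i"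
    and dep: "dependency_graph M G A"
  shows "measure M (\<Inter>i. space M - A i) > 0"
proof -
  interpret prob_space M by (rule M)
  obtain h :: "'n set \<Rightarrow> nat" where h: "inj h"
    using finite_imp_inj_to_nat_seg[of "UNIV :: 'n set set"] by auto
  define f where "f \<omega> = real (h {i. \<omega> \<in> A i})" for \<omega>
  define N where "N = distr M (count_space UNIV) f"
  define B where "B i = {x. \<exists>S. i \<in> S \<and> x = real (h S)}" for i
  have fB: "f -` B i = A i" for i
    using h by (auto simp: f_def B_def inj_eq)
  have atom: "{\<omega> \<in> space M. {i. \<omega> \<in> A i} = S} \<in> sets M" for S
  proof -
    have "{\<omega> \<in> space M. {i. \<omega> \<in> A i} = S} =
          {\<omega> \<in> space M. \<forall>i \<in> UNIV. (\<omega> \<in> A i) = (i \<in> S)}" by auto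
    also have "\<dots> \<in> sets M"
      using A by (intro sets.sets_Collect_finite_All) auto
    finally show ?thesis .
  qed
  have f: "f \<in> measurable M (count_space UNIV)"
  proof -
    have "(\<lambda>\<omega>. {i. \<omega> \<in> A i}) \<in> measurable M (count_space UNIV)"
    proof (rule measurableI)
      fix X :: "'n set set"
      have "(\<lambda>\<omega>. {i. \<omega> \<in> A i}) -` X \<inter> space M = (\<Union>S\<in>X. {\<omega> \<in> space M. {i. \<omega> \<in> A i} = S})"
        by auto
      also have "\<dots> \<in> sets M" by (intro sets.finite_UN atom) auto
      finally show "(\<lambda>\<omega>. {i. \<omega> \<in> A i}) -` X \<inter> space M \<in> sets M" .
    qed auto
    from measurable_compose[OF this, of "\<lambda>S. real (h S)" "count_space UNIV"]
    show ?thesis by (simp add: f_def[abs_def])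
  qed
  have N: "prob_space N" unfolding N_def by (rule prob_space_distr[OF f])
  have mN: "measure N X = measure M (f -` X \<inter> space M)" for X
    unfolding N_def using f by (subst measure_distr) auto
  have spN: "space N = UNIV" "sets N = UNIV" by (simp_all add: N_def)
  have As: "A i \<inter> space M = A i" for i using sets.sets_into_space[OF A, of i] by auto
  have sig: "f -` X \<inter> space M \<in> sigma_sets (space M) (A ` J)"
    if "X \<in> sigma_sets UNIV (B ` J)" for X J
    using that
  proof induction
    case (Basic a)
    then show ?case by (auto simp: fB As)
  next
    case Empty
    then show ?case by (auto intro: sigma_sets.Empty)
  next
    case (Compl a)
    have "f -` (UNIV - a) \<inter> space M = space M - (f -` a \<inter> space M)" by auto
    then show ?case using Compl by (auto intro: sigma_sets.Compl)
  next
    case (Union a)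
    have "f -` (\<Union>k. a k) \<inter> space M = (\<Union>k. f -` a k \<inter> space M)" by auto
    then show ?case using Union by (simp only: sigma_sets.Union)
  qed
  have "dependency_graph N G B"
    unfolding dependency_graph_def prob_space.indep_sets2_eq[OF N]
  proof (intro allI conjI ballI)
    fix i X Y
    assume X: "X \<in> {B i}" and Y: "Y \<in> sigma_sets (space N) (B ` {j. j \<noteq> i \<and> (i, j) \<notin> G})"
    have "prob (A i \<inter> (f -` Y \<inter> space M)) = prob (A i) * prob (f -` Y \<inter> space M)"
      using dep sig Y unfolding dependency_graph_def indep_sets2_eq by (auto simp: spN)
    moreover have "f -` (B i \<inter> Y) \<inter> space M = A i \<inter> (f -` Y \<inter> space M)"
      by (auto simp: fB)
    ultimately show "measure N (X \<inter> Y) = measure N X * measure N Y"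
      using X by (simp add: mN fB As)
  qed (auto simp: spN)
  moreover have "measure N (B i) = p $ i" for i by (simp add: mN fB As Ap)
  ultimately have "measure N (\<Inter>i. space N - B i) > 0"
    using p N spN(2) unfolding abstract_interior_def by blast
  moreover have "f -` (\<Inter>i. UNIV - B i) \<inter> space M = (\<Inter>i. space M - A i)"
  proof -
    have "\<omega> \<in> f -` B i \<longleftrightarrow> \<omega> \<in> A i" for \<omega> i by (simp add: fB)
    then show ?thesis by auto
  qed
  ultimately show ?thesis by (simp add: mN spN)
qed

end

theory Submission
  imports Defs
begin

text \<open>
  For an exclusive family the avoidance probabilities \<open>P S\<close> satisfy the recursion
  \<open>P S = P (S - v) - q v * P (S - v - N v)\<close> of the independence polynomial, for any other family
  with the same dependency graph only \<open>\<ge>\<close> holds (Shearer). So an exclusive family with positive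
  avoidance probability shows that its vector lies in the abstract interior, and exclusive families
  can be scaled down from the boundary to the whole interior.

  Conversely, if there is no gap, the independence polynomial is nonnegative at the boundary
  vector, since otherwise Shearer's extremal space at its first zero along the ray would be a
  counterexample. The boundary vector is also realised by a family covering the cube: in a covering
  family each variable may be replaced, up to a small error, by one with boundedly many values
  (Caratheodory), and discrete covering families form a compact set. Equality throughout
  Shearer's inequality then forces the covering family to be exclusive.
\<close>

text \<open>The obstacle is that leaving the interior only provides covering families at
  \<open>(1 + \<epsilon>) *\<^sub>R q\<close>, and measurable sets lack the needed compactness: a
  weak limit of indicator functions need not be an indicator. With finitely many values per
  variable, a family becomes one of finitely many patterns together with a point of a product of
  simplices, provided that the number of values is bounded independently of the family. This is
  where \<open>CARD('n) + 1\<close> comes from: when a single variable is replaced, only the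
  \<open>CARD('n)\<close> measures of the events must be kept, so a mean in dimension
  \<open>CARD('n)\<close> is approximated by a short convex combination. Keeping the uncovered set
  null costs no further atom, since almost every value of the variable may serve as an atom.
  Connectedness enters because equality in Shearer's inequality spreads along edges; with two
  components, one could cover the cube alone and leave the other unconstrained. The absence of a gap
  is used only for nonnegativity of the polynomial at the boundary vector; that it vanishes there is
  forced by the covering family.\<close>

lemma connected_cut:
  assumes conn: "graph_connected G" and G: "sym G" and S: "S \<noteq> {}" "S \<noteq> UNIV"
  obtains u w where "u \<in> S" "w \<notin> S" "(w, u) \<in> G"
proof -
  obtain a b where ab: "a \<in> S" "b \<notin> S" using S by auto
  have "(a, b) \<in> G\<^sup>*" using conn by (simp add: graph_connected_def)
  then have "\<exists>u w. u \<in> S \<and> w \<notin> S \<and> (u, w) \<in> G"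
    using ab
  proof (induction rule: rtrancl_induct)
    case (step y z)
    then show ?case by (cases "y \<in> S") auto
  qed simp
  then show ?thesis using that G by (meson symD)
qed

text \<open>The finite intersections of the events form a generator closed under intersection, so
  the product formula on them extends to the generated sigma-algebra. Intersecting with
  \<open>space M\<close> takes care of \<open>K = {}\<close>, where the intersection over
  \<open>K\<close> is \<open>UNIV\<close>.\<close>

lemma dependency_graphI:
  fixes A :: "'n::finite \<Rightarrow> 'a set"
  assumes M: "prob_space M" and A: "\<And>i. A i \<in> sets M"
    and indep: "\<And>i K. K \<subseteq> {j. j \<noteq> i \<and> (i, j) \<notin> G} \<Longrightarrow>
      measure M (A i \<inter> ((\<Inter>j\<in>K. space M \<inter> A j) \<inter> space M)) =
      measure M (A i) * measure M ((\<Inter>j\<in>K. space M \<inter> A j) \<inter> space M)"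
  shows "dependency_graph M G A"
  unfolding dependency_graph_def
proof
  fix i
  interpret prob_space M by (rule M)
  let ?J = "{j. j \<noteq> i \<and> (i, j) \<notin> G}"
  let ?C = "(\<lambda>K. (\<Inter>j\<in>K. space M \<inter> A j) \<inter> space M) ` Pow ?J"
  have ev: "(\<Inter>j\<in>K. space M \<inter> A j) \<inter> space M \<in> events" for K
  proof (cases "K = {}")
    case False
    then show ?thesis using A by (intro sets.Int sets.finite_INT) auto
  qed simp
  have "indep_set (sigma_sets (space M) {A i}) (sigma_sets (space M) ?C)"
  proof (rule indep_set_sigma_sets)
    show "indep_set {A i} ?C"
      unfolding indep_sets2_eq using A indep ev by auto
    show "Int_stable ?C"
    proof (rule Int_stableI)
      fix a b assume "a \<in> ?C" "b \<in> ?C"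
      then obtain K L where KL: "K \<subseteq> ?J" "L \<subseteq> ?J"
        and "a = (\<Inter>j\<in>K. space M \<inter> A j) \<inter> space M" "b = (\<Inter>j\<in>L. space M \<inter> A j) \<inter> space M"
        by blast
      then have "a \<inter> b = (\<Inter>j\<in>K \<union> L. space M \<inter> A j) \<inter> space M" by auto
      then show "a \<inter> b \<in> ?C" using KL by (intro image_eqI[of _ _ "K \<union> L"]) auto
    qed
  qed (auto simp: Int_stable_def)
  moreover have "sigma_sets (space M) (A ` ?J) \<subseteq> sigma_sets (space M) ?C"
  proof (rule sigma_sets_mono, rule subsetI)
    fix a assume "a \<in> A ` ?J"
    then obtain j where j: "j \<in> ?J" "a = A j" by auto
    then have "a = (\<Inter>j\<in>{j}. space M \<inter> A j) \<inter> space M"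
      using sets.sets_into_space[OF A, of j] by auto
    then show "a \<in> sigma_sets (space M) ?C"
      using j by (intro sigma_sets.Basic image_eqI[of _ _ "{j}"]) auto
  qed
  ultimately show "indep_set {A i} (sigma_sets (space M) (A ` ?J))"
    unfolding indep_sets2_eq by (meson sigma_sets.Basic singletonI singletonD subset_eq)
qed

subsection \<open>The independence polynomial\<close>

definition independent_in :: "('a \<times> 'a) set \<Rightarrow> 'a set \<Rightarrow> bool" where
  "independent_in G U \<longleftrightarrow> (\<forall>u\<in>U. \<forall>v\<in>U. (u, v) \<notin> G)"

text \<open>The probability that all events of \<open>U\<close> occur if adjacent events exclude
  each other and nonadjacent ones are mutually independent.\<close>

definition indep_weight :: "('a \<times> 'a) set \<Rightarrow> ('a \<Rightarrow> real) \<Rightarrow> 'a set \<Rightarrow> real" where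
  "indep_weight G q U = (if independent_in G U then \<Prod>u\<in>U. q u else 0)"

text \<open>Inclusion-exclusion for the probability that no event of \<open>S\<close> occurs, with
  \<open>indep_weight\<close> as joint probabilities. It is the independence polynomial of the
  induced subgraph at the negated weights.\<close>

definition indep_poly :: "('a \<times> 'a) set \<Rightarrow> ('a \<Rightarrow> real) \<Rightarrow> 'a set \<Rightarrow> real" where
  "indep_poly G q S = (\<Sum>U\<in>Pow S. (- 1) ^ card U * indep_weight G q U)"

lemma independent_in_Un:
  assumes "sym G"
  shows "independent_in G (T \<union> W) \<longleftrightarrow>
    independent_in G T \<and> independent_in G W \<and> W \<inter> G `` T = {}"
  using assms unfolding independent_in_def sym_def by blast

lemma indep_weight_Un:
  fixes T W :: "'a::finite set"
  assumes "sym G" "T \<inter> W = {}"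
  shows "indep_weight G q (T \<union> W) =
    (if W \<inter> G `` T = {} then indep_weight G q T * indep_weight G q W else 0)"
  using assms by (auto simp: indep_weight_def independent_in_Un prod.union_disjoint)

lemma indep_poly_empty [simp]: "indep_poly G q {} = 1"
  by (simp add: indep_poly_def indep_weight_def independent_in_def)

text \<open>Subsets of \<open>S\<close> are split by whether they contain \<open>v\<close>; those
  that do contribute only if they miss all neighbours of \<open>v\<close>.\<close>

lemma indep_poly_rec:
  fixes v :: "'a::finite"
  assumes G: "sym G" "irrefl G" and v: "v \<in> S"
  shows "indep_poly G q S = indep_poly G q (S - {v}) - q v * indep_poly G q (S - {v} - G `` {v})"
proof -
  let ?S = "S - {v}"
  let ?h = "\<lambda>U. (- 1) ^ card U * indep_weight G q U"
  have S: "S = insert v ?S" using v by auto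
  have "indep_poly G q S = sum ?h (Pow ?S \<union> insert v ` Pow ?S)"
    unfolding indep_poly_def by (subst S, subst Pow_insert) simp
  also have "\<dots> = sum ?h (Pow ?S) + sum ?h (insert v ` Pow ?S)"
    by (rule sum.union_disjoint) auto
  also have "sum ?h (insert v ` Pow ?S) = (\<Sum>U\<in>Pow ?S. ?h (insert v U))"
    by (subst sum.reindex) (auto simp: inj_on_def)
  also have "\<dots> = (\<Sum>U\<in>Pow ?S. if U \<inter> G `` {v} = {} then - q v * ?h U else 0)"
  proof (rule sum.cong[OF refl])
    fix U assume U: "U \<in> Pow ?S"
    have "indep_weight G q {v} = q v"
      using G by (auto simp: indep_weight_def independent_in_def irrefl_def)
    then have "indep_weight G q (insert v U) =
        (if U \<inter> G `` {v} = {} then q v * indep_weight G q U else 0)"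
      using indep_weight_Un[OF G(1), of "{v}" U q] U by (cases "U \<inter> G `` {v} = {}") auto
    moreover have "card (insert v U) = Suc (card U)" using U by (intro card_insert_disjoint) auto
    ultimately show "?h (insert v U) = (if U \<inter> G `` {v} = {} then - q v * ?h U else 0)"
      by simp
  qed
  also have "\<dots> = (\<Sum>U\<in>Pow (?S - G `` {v}). - q v * ?h U)"
    by (rule sum.mono_neutral_cong_right) auto
  also have "\<dots> = - q v * indep_poly G q (?S - G `` {v})"
    by (simp only: indep_poly_def sum_distrib_left)
  finally show ?thesis by (simp add: indep_poly_def)
qed

lemma continuous_on_indep_poly:
  fixes S :: "'a::finite set"
  shows "continuous_on X (\<lambda>t. indep_poly G (\<lambda>i. t * q i) S)"
proof -
  have "continuous_on X (\<lambda>t. indep_weight G (\<lambda>i. t * q i) U)" for U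
    unfolding indep_weight_def by (cases "independent_in G U") (auto intro!: continuous_intros)
  then show ?thesis unfolding indep_poly_def by (intro continuous_intros)
qed

text \<open>A zero would descend to ever smaller sets. If the value at a proper \<open>S\<close> is
  0, connectedness gives \<open>w\<close> outside \<open>S\<close> with a neighbour in
  \<open>S\<close>. The recursion for \<open>insert w S\<close> starts from 0 and must stay
  nonnegative, so the value at \<open>S\<close> without the neighbours of \<open>w\<close> is 0 too.
  The descent cannot reach \<open>{}\<close>, where the value is 1.\<close>

lemma indep_poly_pos_or_UNIV_zero:
  fixes G :: "('a::finite \<times> 'a) set"
  assumes G: "sym G" "irrefl G" and conn: "graph_connected G" and q: "\<And>i. 0 < q i"
    and nn: "\<And>S. 0 \<le> indep_poly G q S" and S: "S \<noteq> UNIV"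
  shows "0 < indep_poly G q S"
proof (rule ccontr)
  assume "\<not> ?thesis"
  then have "indep_poly G q S = 0" using nn[of S] by simp
  then show False using S
  proof (induction "card S" arbitrary: S rule: less_induct)
    case less
    have "S \<noteq> {}" using less.prems by auto
    then obtain u w where uw: "u \<in> S" "w \<notin> S" "(w, u) \<in> G"
      using less.prems(2) connected_cut[OF conn G(1)] by blast
    have "insert w S - {w} = S" using uw by auto
    then have "indep_poly G q (insert w S) = indep_poly G q S - q w * indep_poly G q (S - G `` {w})"
      using indep_poly_rec[OF G, of w "insert w S" q] by simp
    with less.prems nn[of "insert w S"] q[of w] nn[of "S - G `` {w}"]
    have "indep_poly G q (S - G `` {w}) = 0"
      by (smt (verit) mult_pos_pos)
    moreover have "S - G `` {w} \<subset> S" using uw by auto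
    moreover from this have "card (S - G `` {w}) < card S" by (rule psubset_card_mono[rotated]) simp
    ultimately show ?case using less.hyps by blast
  qed
qed

text \<open>This is Moebius inversion on the subset lattice. The exponent adds the cardinalities
  instead of subtracting them, which has the same parity.\<close>

lemma alternating_sum_interval:
  fixes K U :: "'a::finite set"
  shows "(\<Sum>T | K \<subseteq> T \<and> T \<subseteq> U. (- 1) ^ (card U + card T) :: real) = (if K = U then 1 else 0)"
proof (cases "K \<subset> U")
  case True
  have "(\<Sum>T | T \<subseteq> U \<and> K \<subseteq> T. (- 1) ^ card T :: real) = 0"
    using card_subsupersets_even_odd[OF _ True]
    by (intro sum_alternating_cancels) (auto simp: conj_assoc)
  then show ?thesis using True
    by (auto simp: power_add conj_commute simp flip: sum_distrib_left)
next
  case False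
  show ?thesis
  proof (cases "K = U")
    case True
    then have "{T. K \<subseteq> T \<and> T \<subseteq> U} = {U}" by auto
    then show ?thesis using True by (simp flip: mult_2 power_add)
  next
    case neq: False
    then have "{T. K \<subseteq> T \<and> T \<subseteq> U} = {}" using False by auto
    then show ?thesis using neq by (simp only: sum.empty if_False)
  qed
qed

text \<open>Shearer's extremal space: the random set of occurring events is always independent.\<close>

definition shearer_weight :: "('a::finite \<times> 'a) set \<Rightarrow> ('a \<Rightarrow> real) \<Rightarrow> 'a set \<Rightarrow> real" where
  "shearer_weight G q T = (\<Sum>U | T \<subseteq> U. (- 1) ^ (card U + card T) * indep_weight G q U)"

text \<open>Writing \<open>U = T \<union> W\<close>, only those \<open>W\<close> survive that avoid
  \<open>T\<close> and its neighbours. The product form shows that these signed weights are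
  nonnegative as soon as the polynomial is nonnegative on all sets.\<close>

lemma shearer_weight_eq:
  assumes G: "sym G"
  shows "shearer_weight G q T = indep_weight G q T * indep_poly G q (- (T \<union> G `` T))"
proof -
  have "bij_betw (\<lambda>W. T \<union> W) (Pow (- T)) {U. T \<subseteq> U}"
    by (rule bij_betwI[where g = "\<lambda>U. U - T"]) auto
  then have "shearer_weight G q T =
      (\<Sum>W\<in>Pow (- T). (- 1) ^ (card (T \<union> W) + card T) * indep_weight G q (T \<union> W))"
    unfolding shearer_weight_def by (rule sum.reindex_bij_betw[symmetric])
  also have "\<dots> = (\<Sum>W\<in>Pow (- (T \<union> G `` T)). indep_weight G q T * ((- 1) ^ card W * indep_weight G q W))"
  proof (rule sum.mono_neutral_cong_right)
    fix W assume W: "W \<in> Pow (- (T \<union> G `` T))"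
    then have "card (T \<union> W) + card T = card W + 2 * card T"
      by (subst card_Un_disjoint) auto
    moreover have "indep_weight G q (T \<union> W) = indep_weight G q T * indep_weight G q W"
      using W by (subst indep_weight_Un[OF G]) auto
    ultimately show "(- 1) ^ (card (T \<union> W) + card T) * indep_weight G q (T \<union> W) =
        indep_weight G q T * ((- 1) ^ card W * indep_weight G q W)"
      by (simp add: power_add)
  next
    show "\<forall>W\<in>Pow (- T) - Pow (- (T \<union> G `` T)).
        (- 1) ^ (card (T \<union> W) + card T) * indep_weight G q (T \<union> W) = 0"
    proof
      fix W assume W: "W \<in> Pow (- T) - Pow (- (T \<union> G `` T))"
      then have "T \<inter> W = {}" "W \<inter> G `` T \<noteq> {}" by auto
      then show "(- 1) ^ (card (T \<union> W) + card T) * indep_weight G q (T \<union> W) = 0"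
        by (simp add: indep_weight_Un[OF G])
    qed
  qed auto
  finally show ?thesis by (simp add: indep_poly_def sum_distrib_left)
qed

text \<open>Exchanging the sums leaves the alternating sum over an interval of sets. The case
  \<open>K = {}\<close> gives total mass 1, singletons give the prescribed event probabilities, and
  general \<open>K\<close> gives the joint probabilities.\<close>

lemma sum_shearer_weight:
  fixes K :: "'a::finite set"
  shows "(\<Sum>T | K \<subseteq> T. shearer_weight G q T) = indep_weight G q K"
proof -
  have "(\<Sum>T | K \<subseteq> T. shearer_weight G q T) =
      (\<Sum>T\<in>{T. K \<subseteq> T}. \<Sum>U | U \<in> UNIV \<and> T \<subseteq> U. (- 1) ^ (card U + card T) * indep_weight G q U)"
    by (simp add: shearer_weight_def)
  also have "\<dots> = (\<Sum>U\<in>UNIV. \<Sum>T | T \<in> {T. K \<subseteq> T} \<and> T \<subseteq> U. (- 1) ^ (card U + card T) * indep_weight G q U)"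
    by (rule sum.swap_restrict) auto
  also have "\<dots> = (\<Sum>U\<in>UNIV. (\<Sum>T | K \<subseteq> T \<and> T \<subseteq> U. (- 1) ^ (card U + card T)) * indep_weight G q U)"
    by (simp add: sum_distrib_right)
  also have "\<dots> = (\<Sum>U\<in>UNIV. if K = U then indep_weight G q U else 0)"
    by (intro sum.cong refl) (simp add: alternating_sum_interval)
  also have "\<dots> = indep_weight G q K" by simp
  finally show ?thesis .
qed

text \<open>Draw a random set with weights \<open>shearer_weight\<close> and let event
  \<open>i\<close> be that \<open>i\<close> belongs to it. No event occurs exactly when the set is
  empty, which has probability \<open>indep_poly\<close> at \<open>UNIV\<close>, that is 0.\<close>

lemma not_abstract_interior_if_indep_poly_zero:
  fixes q :: "real ^ 'n::finite"
  assumes G: "sym G" "irrefl G"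
    and nn: "\<And>S. 0 \<le> indep_poly G (($) q) S" and q: "\<And>i. 0 < q $ i"
    and zero: "indep_poly G (($) q) UNIV = 0"
  shows "q \<notin> abstract_interior G"
proof
  assume ai: "q \<in> abstract_interior G"
  let ?w = "shearer_weight G (($) q)" and ?f = "indep_weight G (($) q)"
  have w0: "0 \<le> ?w T" for T
    unfolding shearer_weight_eq[OF G(1)]
    by (intro mult_nonneg_nonneg nn) (auto simp: indep_weight_def intro!: prod_nonneg less_imp_le[OF q])
  have f0: "?f {} = 1" by (simp add: indep_weight_def independent_in_def)
  have "(\<Sum>T\<in>UNIV. ?w T) = 1" using sum_shearer_weight[where K = "{}" and G = G and q = "($) q"] f0 by simp
  then have "(\<integral>\<^sup>+ T. ennreal (?w T) \<partial>count_space UNIV) = 1"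
    by (simp add: nn_integral_count_space_finite w0 sum_nonneg flip: ennreal_1)
  then have pmf: "pmf (embed_pmf ?w) T = ?w T" for T by (intro pmf_embed_pmf w0)
  define M where "M = measure_pmf (embed_pmf ?w)"
  interpret prob_space M unfolding M_def by (rule measure_pmf.prob_space_axioms)
  have sM: "sets M = UNIV" "space M = UNIV" by (simp_all add: M_def)
  have mM: "prob {T. K \<subseteq> T} = ?f K" for K
    using sum_shearer_weight[where K = K and G = G and q = "($) q"] by (simp add: M_def measure_measure_pmf_finite pmf)
  define A where "A i = {T. i \<in> T}" for i :: 'n
  have AK: "A i = {T. {i} \<subseteq> T}" for i by (auto simp: A_def)
  have fi: "?f {i} = q $ i" for i
    using G by (auto simp: indep_weight_def independent_in_def irrefl_def)
  have pA: "prob (A i) = q $ i" for i by (simp only: AK mM fi)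
  have "dependency_graph M G A"
  proof (rule dependency_graphI)
    fix i K assume K: "K \<subseteq> {j. j \<noteq> i \<and> (i, j) \<notin> G}"
    have "(\<Inter>j\<in>K. space M \<inter> A j) \<inter> space M = {T. K \<subseteq> T}" by (auto simp: A_def sM)
    moreover have "A i \<inter> {T. K \<subseteq> T} = {T. {i} \<union> K \<subseteq> T}" by (auto simp: A_def)
    \<comment> \<open>No element of \<open>K\<close> is adjacent to \<open>i\<close>, so the weight
      factors; if \<open>K\<close> is not independent, both sides are 0.\<close>
    moreover have "?f ({i} \<union> K) = ?f {i} * ?f K" using K by (subst indep_weight_Un[OF G(1)]) auto
    ultimately show "prob (A i \<inter> ((\<Inter>j\<in>K. space M \<inter> A j) \<inter> space M)) =
        prob (A i) * prob ((\<Inter>j\<in>K. space M \<inter> A j) \<inter> space M)"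
      by (simp only: mM pA fi)
  qed (auto simp: sM prob_space_axioms)
  from abstract_interiorD[OF ai prob_space_axioms _ pA this]
  have "0 < prob (\<Inter>i. space M - A i)" by (simp add: sM)
  also have "(\<Inter>i. space M - A i) = {{}}" by (auto simp: A_def sM)
  also have "prob {{}} = ?w {}" by (simp add: M_def pmf measure_pmf_single)
  also have "\<dots> = indep_poly G (($) q) UNIV" by (simp add: shearer_weight_eq[OF G(1)] f0)
  finally show False using zero by simp
qed

subsection \<open>Shearer's inequality\<close>

text \<open>Here \<open>P S\<close> and \<open>I S\<close> are the probabilities of avoiding all events in \<open>S\<close>, for a given
  family and for the extremal one; the quotient \<open>P / I\<close> increases with the set.\<close>

lemma shearer_ratio_mono:
  fixes P I :: "'a::finite set \<Rightarrow> real"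
  assumes Irec: "\<And>S v. v \<in> S \<Longrightarrow> I S = I (S - {v}) - q v * I (S - {v} - G `` {v})"
    and Prec: "\<And>S v. v \<in> S \<Longrightarrow> P S \<ge> P (S - {v}) - q v * P (S - {v} - G `` {v})"
    and q: "\<And>v. 0 \<le> q v" and Ipos: "\<And>S. S \<noteq> UNIV \<Longrightarrow> 0 < I S" and I0: "0 \<le> I UNIV"
    and TS: "T \<subseteq> S"
  shows "P T * I S \<le> P S * I T"
  using TS
proof (induction "card S" arbitrary: S T rule: less_induct)
  case less
  show ?case
  proof (cases "T = S")
    case False
    then obtain v where v: "v \<in> S" "v \<notin> T" using less.prems by auto
    let ?S = "S - {v}"
    let ?R = "?S - G `` {v}"
    have card: "card ?S < card S" using v by (intro card_Diff1_less) auto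
    have Ipos': "0 < I ?S" "0 < I ?R" "0 < I T" using v by (auto intro!: Ipos)
    have IS: "0 \<le> I S" using Ipos[of S] I0 by (cases "S = UNIV") auto
    \<comment> \<open>Quotients are cross-multiplied because \<open>I UNIV\<close> may vanish. By
      induction the quotient at \<open>?R\<close> is at most that at \<open>?S\<close>, so adding
      \<open>v\<close> costs \<open>P\<close> proportionally no more than it costs
      \<open>I\<close>.\<close>
    have "q v * (P ?R * I ?S) \<le> q v * (P ?S * I ?R)"
      using less.hyps[OF card, of ?R] by (intro mult_left_mono q) auto
    moreover have "(P ?S - q v * P ?R) * I ?S \<le> P S * I ?S"
      using Prec[OF v(1)] Ipos'(1) by (intro mult_right_mono) auto
    ultimately have step: "P ?S * I S \<le> P S * I ?S"
      by (simp add: Irec[OF v(1)] algebra_simps)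
    have "P T * I ?S \<le> P ?S * I T" using less.hyps[OF card, of T] less.prems v by auto
    then have "(P T * I ?S) * I S \<le> (P ?S * I T) * I S" using IS by (rule mult_right_mono)
    also have "\<dots> \<le> (P S * I ?S) * I T"
      using mult_right_mono[OF step, of "I T"] Ipos' by (simp add: ac_simps)
    finally have "(P T * I S) * I ?S \<le> (P S * I T) * I ?S" by (simp add: ac_simps)
    then show ?thesis using Ipos'(1) by (simp add: mult_le_cancel_right)
  qed simp
qed

text \<open>The quotient of \<open>P\<close> by \<open>I\<close> increases from 1 at
  \<open>{}\<close>. Equality at \<open>UNIV\<close> makes its largest value \<open>c\<close> common
  to all sets \<open>UNIV - {v}\<close>, and a set with value \<open>c\<close> always yields a
  smaller one with value \<open>c\<close>. Reaching \<open>{}\<close> shows \<open>c = 1\<close>, so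
  the quotient is constant.\<close>

lemma shearer_boundary_rigidity:
  fixes P I :: "'a::finite set \<Rightarrow> real"
  assumes G: "sym G" "irrefl G" and conn: "graph_connected G"
    and Irec: "\<And>S v. v \<in> S \<Longrightarrow> I S = I (S - {v}) - q v * I (S - {v} - G `` {v})"
    and Prec: "\<And>S v. v \<in> S \<Longrightarrow> P S \<ge> P (S - {v}) - q v * P (S - {v} - G `` {v})"
    and q: "\<And>v. 0 < q v" and Ipos: "\<And>S. S \<noteq> UNIV \<Longrightarrow> 0 < I S" and I0: "0 \<le> I UNIV"
    and empty: "P {} = 1" "I {} = 1" and PU: "P UNIV = 0"
  shows "P S = I S"
proof -
  have mono: "P T * I S \<le> P S * I T" if "T \<subseteq> S" for T S
    by (rule shearer_ratio_mono[where q = q and G = G, OF Irec Prec less_imp_le[OF q] Ipos I0 that])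
  \<comment> \<open>Meaningful on proper subsets only: \<open>I UNIV\<close> turns out to be 0 and
    is treated separately.\<close>
  define \<rho> where "\<rho> S = P S / I S" for S
  have P\<rho>: "P S = \<rho> S * I S" if "S \<noteq> UNIV" for S
    using Ipos[OF that] by (simp add: \<rho>_def)
  have \<rho>_mono: "\<rho> T \<le> \<rho> S" if "T \<subseteq> S" "S \<noteq> UNIV" for T S
  proof -
    have "T \<noteq> UNIV" using that by auto
    then show ?thesis
      using mono[OF that(1)] Ipos[OF that(2)] Ipos[of T] by (simp add: \<rho>_def frac_le_eq divide_simps)
  qed
  have IU: "I UNIV = 0" using mono[of "{}" UNIV] I0 by (simp add: empty PU)
  \<comment> \<open>At \<open>UNIV\<close> both quantities are 0, so
    \<open>I ?S = q v * I ?R\<close> while \<open>P ?S \<le> q v * P ?R\<close>; this reverses the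
    monotonicity of the quotient.\<close>
  have drop: "\<rho> (UNIV - {v} - G `` {v}) = \<rho> (UNIV - {v})" for v
  proof -
    let ?S = "UNIV - {v}" and ?R = "UNIV - {v} - G `` {v}"
    have ne: "?S \<noteq> UNIV" "?R \<noteq> UNIV" by auto
    have "\<rho> ?S * I ?S \<le> \<rho> ?R * I ?S"
      using Prec[of v UNIV] Irec[of v UNIV] PU IU by (simp add: P\<rho>[OF ne(1)] P\<rho>[OF ne(2)] ac_simps)
    then have "\<rho> ?S \<le> \<rho> ?R" using Ipos[OF ne(1)] by (simp add: mult_le_cancel_right)
    with \<rho>_mono[of ?R ?S] show ?thesis by force
  qed
  have edge: "\<rho> (UNIV - {u}) = \<rho> (UNIV - {v})" if "(u, v) \<in> G" for u v
  proof -
    \<comment> \<open>The set \<open>UNIV - {u, v}\<close> is squeezed between the two sets of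
      \<open>drop\<close> for \<open>u\<close>. It is symmetric in \<open>u\<close> and
      \<open>v\<close>, so both ends of an edge share one value.\<close>
    have *: "\<rho> (UNIV - {u, v}) = \<rho> (UNIV - {u})" if "(u, v) \<in> G" for u v
    proof (rule antisym)
      have "UNIV - {u} - G `` {u} \<subseteq> UNIV - {u, v}" using that by auto
      then have "\<rho> (UNIV - {u} - G `` {u}) \<le> \<rho> (UNIV - {u, v})" by (rule \<rho>_mono) auto
      then show "\<rho> (UNIV - {u}) \<le> \<rho> (UNIV - {u, v})" by (simp only: drop)
    qed (rule \<rho>_mono; auto)
    show ?thesis using *[OF that] *[OF symD[OF G(1) that]] by (simp add: insert_commute)
  qed
  obtain v0 :: 'a where True by simp
  define c where "c = \<rho> (UNIV - {v0})"
  have c: "\<rho> (UNIV - {v}) = c" for v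
  proof -
    have "(v0, v) \<in> G\<^sup>*" using conn by (simp add: graph_connected_def)
    then show ?thesis by (induction rule: rtrancl_induct) (simp_all add: c_def edge)
  qed
  have le_c: "\<rho> S \<le> c" if ne: "S \<noteq> UNIV" for S
  proof -
    obtain x where "x \<notin> S" using ne by auto
    then have "\<rho> S \<le> \<rho> (UNIV - {x})" by (intro \<rho>_mono) auto
    then show ?thesis by (simp add: c)
  qed
  have "\<rho> {} = c" if "S \<noteq> UNIV" "\<rho> S = c" for S
    using that
  proof (induction "card S" arbitrary: S rule: less_induct)
    case less
    show ?case
    proof (cases "S = {}")
      case False
      then obtain u w where uw: "u \<in> S" "w \<notin> S" "(w, u) \<in> G"
        using connected_cut[OF conn G(1)] less.prems(1) by metis
      let ?R = "S - G `` {w}" and ?S = "insert w S"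
      have R: "?R \<noteq> UNIV" using uw by auto
      have Sw: "?S - {w} = S" using uw by auto
      have "\<rho> ?R = c"
      proof (cases "?S = UNIV")
        case True
        then have S: "S = UNIV - {w}" using uw by auto
        show ?thesis using drop[of w] c[of w] by (simp add: S)
      next
        case ne: False
        have "\<rho> S \<le> \<rho> ?S" using ne by (intro \<rho>_mono) auto
        then have "\<rho> ?S = c" using le_c[OF ne] less.prems by simp
        \<comment> \<open>Both \<open>S\<close> and \<open>?S\<close> have quotient
          \<open>c\<close>, so subtracting \<open>c\<close> times the exact recursion for
          \<open>I\<close> leaves \<open>c \<le> \<rho> ?R\<close>.\<close>
        then have "c * I ?S \<ge> c * I S - q w * (\<rho> ?R * I ?R)"
          using Prec[of w ?S] by (simp add: Sw P\<rho>[OF ne] P\<rho>[OF R] P\<rho>[OF less.prems(1)] less.prems(2))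
        then have "(q w * I ?R) * c \<le> (q w * I ?R) * \<rho> ?R"
          using Irec[of w ?S] by (simp add: Sw algebra_simps)
        then have "c \<le> \<rho> ?R" using q[of w] Ipos[OF R] by (simp add: mult_le_cancel_left)
        then show ?thesis using le_c[OF R] by simp
      qed
      moreover have "card ?R < card S" using uw by (intro psubset_card_mono) auto
      ultimately show ?thesis using less.hyps R by blast
    qed (use less.prems in simp)
  qed
  from this[of "UNIV - {v0}"] have "c = 1" using c[of v0] by (auto simp: \<rho>_def empty)
  show ?thesis
  proof (cases "S = UNIV")
    case False
    have "\<rho> {} \<le> \<rho> S" using False by (intro \<rho>_mono) auto
    then have "\<rho> S = 1" using le_c[OF False] \<open>c = 1\<close> by (simp add: \<rho>_def empty)
    then show ?thesis using P\<rho>[OF False] by simp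
  qed (simp add: PU IU)
qed

section \<open>Avoidance probabilities under a dependency graph\<close>

definition avoiding :: "'b measure \<Rightarrow> ('a \<Rightarrow> 'b set) \<Rightarrow> 'a set \<Rightarrow> 'b set" where
  "avoiding M A S = {x \<in> space M. \<forall>i\<in>S. x \<notin> A i}"

lemma avoiding_eq: "avoiding M A S = space M - (\<Union>i\<in>S. A i)"
  by (auto simp: avoiding_def)

lemma avoiding_sigma_sets:
  fixes S :: "'a::finite set"
  assumes "\<And>i. A i \<subseteq> space M"
  shows "avoiding M A S \<in> sigma_sets (space M) (A ` S)"
proof -
  interpret \<Sigma>: sigma_algebra "space M" "sigma_sets (space M) (A ` S)"
    using assms by (intro sigma_algebra_sigma_sets) auto
  show ?thesis unfolding avoiding_eq by (intro \<Sigma>.compl_sets \<Sigma>.finite_UN) auto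
qed

context
  fixes M :: "'b measure" and G :: "('n::finite \<times> 'n) set" and A :: "'n \<Rightarrow> 'b set" and q :: "'n \<Rightarrow> real"
  assumes M: "prob_space M" and A: "\<And>i. A i \<in> sets M"
    and Aq: "\<And>i. measure M (A i) = q i" and dep: "dependency_graph M G A"
begin

interpretation prob_space M by (rule M)

lemma avoiding_sets [measurable]: "avoiding M A S \<in> sets M"
  using A by (auto simp: avoiding_eq)

lemma avoiding_step:
  assumes v: "v \<in> S"
  shows "prob (avoiding M A S) =
    prob (avoiding M A (S - {v})) - prob (A v \<inter> avoiding M A (S - {v}))"
proof -
  have "avoiding M A S = avoiding M A (S - {v}) - A v \<inter> avoiding M A (S - {v})"
    using v by (auto simp: avoiding_def)
  then show ?thesis
    using finite_measure_Diff[of "avoiding M A (S - {v})" "A v \<inter> avoiding M A (S - {v})"] A by simp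
qed

lemma avoiding_indep:
  "prob (A v \<inter> avoiding M A (S - {v} - G `` {v})) = q v * prob (avoiding M A (S - {v} - G `` {v}))"
proof -
  let ?R = "S - {v} - G `` {v}" and ?J = "{j. j \<noteq> v \<and> (v, j) \<notin> G}"
  have "avoiding M A ?R \<in> sigma_sets (space M) (A ` ?R)"
    using sets.sets_into_space[OF A] by (intro avoiding_sigma_sets)
  also have "\<dots> \<subseteq> sigma_sets (space M) (A ` ?J)"
    by (intro sigma_sets_mono') auto
  finally show ?thesis
    using dep by (simp add: dependency_graph_def indep_sets2_eq Aq)
qed

text \<open>The mass lost by also avoiding \<open>A v\<close> only grows when the neighbours of
  \<open>v\<close> are dropped from the condition; after that, independence evaluates it.\<close>

lemma avoiding_rec_ge:
  assumes v: "v \<in> S"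
  shows "prob (avoiding M A S) \<ge>
    prob (avoiding M A (S - {v})) - q v * prob (avoiding M A (S - {v} - G `` {v}))"
proof -
  have "prob (A v \<inter> avoiding M A (S - {v})) \<le> prob (A v \<inter> avoiding M A (S - {v} - G `` {v}))"
    using A by (intro finite_measure_mono) (auto simp: avoiding_def)
  then show ?thesis by (simp add: avoiding_step[OF v] avoiding_indep)
qed

text \<open>Almost nowhere on \<open>A v\<close> does a neighbouring event occur, so dropping the
  neighbours from the condition changes nothing up to a null set.\<close>

lemma avoiding_rec_eq:
  assumes v: "v \<in> S" and excl: "\<And>u. (v, u) \<in> G \<Longrightarrow> prob (A v \<inter> A u) = 0"
  shows "prob (avoiding M A S) =
    prob (avoiding M A (S - {v})) - q v * prob (avoiding M A (S - {v} - G `` {v}))"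
proof -
  let ?N = "\<Union>u\<in>G `` {v}. A v \<inter> A u"
  have "?N \<in> null_sets M"
    using A excl by (intro null_sets_UN' countable_finite) (auto simp: null_sets_def emeasure_eq_measure)
  then have N: "prob ?N = 0" "?N \<in> sets M" by (auto simp: null_sets_def measure_def)
  have "prob (A v \<inter> avoiding M A (S - {v} - G `` {v})) \<le>
      prob (A v \<inter> avoiding M A (S - {v}) \<union> ?N)"
    using A N by (intro finite_measure_mono) (auto simp: avoiding_def)
  also have "\<dots> \<le> prob (A v \<inter> avoiding M A (S - {v}))"
    using measure_Un_le[of "A v \<inter> avoiding M A (S - {v})" M ?N] A N by auto
  finally show ?thesis
    using avoiding_rec_ge[OF v] by (simp add: avoiding_step[OF v] avoiding_indep)
qed

end

subsection \<open>Borel cylinder families\<close>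

lemma space_unit_interval [simp]: "space unit_interval = {0..1}"
  by (simp add: unit_interval_def space_restrict_space)

lemma sets_unit_interval_iff: "X \<in> sets unit_interval \<longleftrightarrow> X \<in> sets borel \<and> X \<subseteq> {0..1}"
  by (auto simp: unit_interval_def sets_restrict_space_iff)

lemma emeasure_unit_interval: "X \<subseteq> {0..1} \<Longrightarrow> emeasure unit_interval X = emeasure lborel X"
  by (simp add: unit_interval_def emeasure_restrict_space)

lemma prob_space_unit_interval: "prob_space unit_interval"
  by (intro prob_spaceI) (simp add: emeasure_unit_interval)

abbreviation unit_cube :: "('m \<Rightarrow> real) measure" where
  "unit_cube \<equiv> Pi\<^sub>M UNIV (\<lambda>_. unit_interval)"

interpretation unit: product_prob_space "\<lambda>_. unit_interval" I for I :: "'m set"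
  by (rule product_prob_spaceI) (rule prob_space_unit_interval)

lemma space_unit_cube: "space unit_cube = {x. \<forall>j. x j \<in> {0..1}}"
  by (auto simp: space_PiM)

text \<open>Membership is required to depend only on the coordinates in \<open>J\<close>, with no
  base set mentioned. This makes intersections, complements and enlarging \<open>J\<close>
  immediate; base sets are recovered by \<open>borel_cylinderE\<close>.\<close>

definition borel_cylinder :: "'m set \<Rightarrow> ('m \<Rightarrow> real) set \<Rightarrow> bool" where
  "borel_cylinder J X \<longleftrightarrow> X \<in> sets unit_cube \<and>
     (\<forall>x\<in>space unit_cube. \<forall>y\<in>space unit_cube. (\<forall>j\<in>J. x j = y j) \<longrightarrow> (x \<in> X \<longleftrightarrow> y \<in> X))"

lemma borel_cylinder_sets: "borel_cylinder J X \<Longrightarrow> X \<in> sets unit_cube"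
  by (simp only: borel_cylinder_def)

lemma borel_cylinderD:
  assumes "borel_cylinder J X" "x \<in> space unit_cube" "y \<in> space unit_cube" "\<And>j. j \<in> J \<Longrightarrow> x j = y j"
  shows "x \<in> X \<longleftrightarrow> y \<in> X"
  using assms unfolding borel_cylinder_def by blast

definition borel_family :: "('n \<times> 'm) set \<Rightarrow> ('n \<Rightarrow> ('m \<Rightarrow> real) set) \<Rightarrow> bool" where
  "borel_family E A \<longleftrightarrow> (\<forall>i. borel_cylinder (nbhd E i) (A i))"

lemma borel_familyD:
  assumes "borel_family E A"
  shows "borel_cylinder (nbhd E i) (A i)" "A i \<in> sets unit_cube"
  using assms unfolding borel_family_def borel_cylinder_def by blast+

lemma borel_cylinder_prod_emb:
  assumes "B \<in> sets (Pi\<^sub>M J (\<lambda>_. unit_interval))"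
  shows "borel_cylinder J (prod_emb UNIV (\<lambda>_. unit_interval) J B)"
proof -
  have "restrict x J = restrict y J" if "\<forall>j\<in>J. x j = y j" for x y :: "'a \<Rightarrow> real"
    using that by (auto simp: restrict_def)
  then have "restrict x J \<in> B \<longleftrightarrow> restrict y J \<in> B" if "\<forall>j\<in>J. x j = y j" for x y :: "'a \<Rightarrow> real"
    using that by metis
  then show ?thesis
    using assms unfolding borel_cylinder_def
    by (auto simp: prod_emb_iff space_unit_cube intro!: measurable_prod_emb)
qed

lemma borel_cylinderE:
  assumes X: "borel_cylinder J X"
  obtains B where "B \<in> sets (Pi\<^sub>M J (\<lambda>_. unit_interval))" "X = prod_emb UNIV (\<lambda>_. unit_interval) J B"
proof
  \<comment> \<open>The base set is the section of \<open>X\<close> at 0 in all coordinates outside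
    \<open>J\<close>; any other point of the interval would give the same section.\<close>
  let ?e = "\<lambda>x j. if j \<in> J then x j else (0::real)"
  let ?B = "?e -` X \<inter> space (Pi\<^sub>M J (\<lambda>_. unit_interval))"
  have "?e \<in> measurable (Pi\<^sub>M J (\<lambda>_. unit_interval)) unit_cube"
  proof (rule measurable_PiM_single')
    fix j
    show "(\<lambda>x. ?e x j) \<in> measurable (Pi\<^sub>M J (\<lambda>_. unit_interval)) unit_interval"
      by (cases "j \<in> J") simp_all
  qed (auto simp: space_PiM PiE_iff)
  then show "?B \<in> sets (Pi\<^sub>M J (\<lambda>_. unit_interval))"
    by (rule measurable_sets) (rule borel_cylinder_sets[OF X])
  have eq: "x \<in> X \<longleftrightarrow> ?e (restrict x J) \<in> X" if "x \<in> space unit_cube" for x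
  proof -
    have "?e (restrict x J) \<in> space unit_cube" using that by (auto simp: space_unit_cube)
    then show ?thesis by (intro borel_cylinderD[OF X that]) simp_all
  qed
  have X': "X \<subseteq> space unit_cube" by (rule sets.sets_into_space[OF borel_cylinder_sets[OF X]])
  show "X = prod_emb UNIV (\<lambda>_. unit_interval) J ?B"
  proof (rule set_eqI)
    fix x
    show "x \<in> X \<longleftrightarrow> x \<in> prod_emb UNIV (\<lambda>_. unit_interval) J ?B"
    proof (cases "x \<in> space unit_cube")
      case True
      then have "restrict x J \<in> space (Pi\<^sub>M J (\<lambda>_. unit_interval))" by (auto simp: space_PiM)
      with True show ?thesis
        by (subst eq[OF True]) (simp add: prod_emb_iff space_unit_cube)
    next
      case False
      then show ?thesis using X' by (auto simp: prod_emb_iff space_unit_cube)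
    qed
  qed
qed

lemma borel_cylinder_mono: "borel_cylinder J X \<Longrightarrow> J \<subseteq> K \<Longrightarrow> borel_cylinder K X"
  unfolding borel_cylinder_def by blast

lemma borel_cylinder_Int: "borel_cylinder J X \<Longrightarrow> borel_cylinder J Y \<Longrightarrow> borel_cylinder J (X \<inter> Y)"
  unfolding borel_cylinder_def using sets.Int by blast

lemma borel_cylinder_Compl: "borel_cylinder J X \<Longrightarrow> borel_cylinder J (space unit_cube - X)"
  unfolding borel_cylinder_def using sets.compl_sets by blast

lemma borel_cylinder_space: "borel_cylinder J (space unit_cube)"
  by (simp add: borel_cylinder_def)

lemma borel_cylinder_coordinate:
  fixes j :: "'m::finite"
  assumes "j \<in> J" "I \<in> sets borel"
  shows "borel_cylinder J {x \<in> space unit_cube. x j \<in> I}"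
proof -
  have "I \<inter> {0..1} \<in> sets unit_interval" using assms by (simp add: sets_unit_interval_iff)
  then have "(\<lambda>x. x j) -` (I \<inter> {0..1}) \<inter> space unit_cube \<in> sets unit_cube"
    by (rule measurable_sets[OF measurable_component_singleton[OF UNIV_I]])
  moreover have "(\<lambda>x. x j) -` (I \<inter> {0..1}) \<inter> space unit_cube = {x \<in> space unit_cube. x j \<in> I}"
    by (auto simp: space_unit_cube)
  ultimately show ?thesis using assms by (auto simp: borel_cylinder_def)
qed

lemma borel_cylinder_indep:
  fixes J K :: "'m::finite set"
  assumes X: "borel_cylinder J X" and Y: "borel_cylinder K Y" and JK: "J \<inter> K = {}"
  shows "measure unit_cube (X \<inter> Y) = measure unit_cube X * measure unit_cube Y"
proof -
  let ?P = "\<lambda>J. Pi\<^sub>M J (\<lambda>_::'m. unit_interval)"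
  let ?emb = "prod_emb UNIV (\<lambda>_::'m. unit_interval)"
  \<comment> \<open>With \<open>Y\<close> viewed over the complement of \<open>J\<close>, the cube
    splits into two factors and the intersection becomes a rectangle.\<close>
  have Y': "borel_cylinder (- J) Y" using Y JK by (intro borel_cylinder_mono[OF Y]) auto
  obtain B where B: "B \<in> sets (?P J)" "X = ?emb J B" using X by (rule borel_cylinderE)
  obtain C where C: "C \<in> sets (?P (- J))" "Y = ?emb (- J) C" using Y' by (rule borel_cylinderE)
  have XY: "X \<in> sets unit_cube" "Y \<in> sets unit_cube" using borel_cylinder_sets[OF X] borel_cylinder_sets[OF Y] .
  interpret J: prob_space "?P J" by (intro prob_space_PiM prob_space_unit_interval)
  interpret J': prob_space "?P (- J)" by (intro prob_space_PiM prob_space_unit_interval)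
  have "unit_cube = distr (?P J \<Otimes>\<^sub>M ?P (- J)) unit_cube (merge J (- J))"
    using unit.distr_merge[of J "- J"] by simp
  then have "emeasure unit_cube (X \<inter> Y) =
      emeasure (distr (?P J \<Otimes>\<^sub>M ?P (- J)) unit_cube (merge J (- J))) (X \<inter> Y)" by simp
  also have "\<dots> = emeasure (?P J \<Otimes>\<^sub>M ?P (- J))
      (merge J (- J) -` (X \<inter> Y) \<inter> space (?P J \<Otimes>\<^sub>M ?P (- J)))"
    using measurable_merge[of J "- J" "\<lambda>_. unit_interval"] XY by (intro emeasure_distr) auto
  also have "merge J (- J) -` (X \<inter> Y) \<inter> space (?P J \<Otimes>\<^sub>M ?P (- J)) = B \<times> C"
  proof -
    have "merge J (- J) (x, y) \<in> X \<inter> Y \<longleftrightarrow> x \<in> B \<and> y \<in> C"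
      if "x \<in> space (?P J)" "y \<in> space (?P (- J))" for x y
    proof -
      have "restrict (merge J (- J) (x, y)) J = x" "restrict (merge J (- J) (x, y)) (- J) = y"
        using that by (auto simp: fun_eq_iff space_PiM PiE_iff extensional_def merge_def)
      moreover have "merge J (- J) (x, y) \<in> space unit_cube"
        using that by (auto simp: space_unit_cube space_PiM merge_def PiE_iff Pi_iff)
      ultimately show ?thesis unfolding B C by (auto simp: prod_emb_iff space_unit_cube)
    qed
    moreover have "B \<subseteq> space (?P J)" "C \<subseteq> space (?P (- J))"
      using B(1) C(1) by (auto dest: sets.sets_into_space)
    ultimately show ?thesis unfolding space_pair_measure by blast
  qed
  also have "emeasure (?P J \<Otimes>\<^sub>M ?P (- J)) (B \<times> C) = emeasure (?P J) B * emeasure (?P (- J)) C"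
    using B C by (intro unit.P.emeasure_pair_measure_Times)
  also have "\<dots> = emeasure unit_cube X * emeasure unit_cube Y"
    using B C by simp
  finally show ?thesis by (simp add: measure_def enn2real_mult)
qed

lemma borel_family_dependency_graph:
  fixes E :: "('n::finite \<times> 'm::finite) set"
  assumes A: "borel_family E A"
  shows "dependency_graph unit_cube (base_graph E) A"
proof (rule dependency_graphI)
  show "prob_space unit_cube" by (intro prob_space_PiM prob_space_unit_interval)
  show "A i \<in> sets unit_cube" for i using borel_familyD(2)[OF A] .
  fix i K assume K: "K \<subseteq> {j. j \<noteq> i \<and> (i, j) \<notin> base_graph E}"
  have "borel_cylinder (\<Union>j\<in>L. nbhd E j) ((\<Inter>j\<in>L. space unit_cube \<inter> A j) \<inter> space unit_cube)" for L
  proof (induction L rule: finite_induct[OF finite])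
    case (2 v L)
    have "(\<Inter>j\<in>insert v L. space unit_cube \<inter> A j) \<inter> space unit_cube =
        A v \<inter> ((\<Inter>j\<in>L. space unit_cube \<inter> A j) \<inter> space unit_cube)"
      using sets.sets_into_space[OF borel_familyD(2)[OF A, of v]] by auto
    then show ?case
      by (simp only:, intro borel_cylinder_Int borel_cylinder_mono[OF borel_familyD(1)[OF A, of v]]
          borel_cylinder_mono[OF 2(3)]) auto
  qed (simp add: borel_cylinder_space)
  then show "measure unit_cube (A i \<inter> ((\<Inter>j\<in>K. space unit_cube \<inter> A j) \<inter> space unit_cube)) =
      measure unit_cube (A i) * measure unit_cube ((\<Inter>j\<in>K. space unit_cube \<inter> A j) \<inter> space unit_cube)"
    by (rule borel_cylinder_indep[OF borel_familyD(1)[OF A]]) (use K in \<open>auto simp: base_graph_def\<close>)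
qed

section \<open>From Lebesgue measurable to Borel measurable families\<close>

lemma measure_completion_sandwich:
  assumes "X \<in> sets (completion M)" "Y \<in> sets M" "N \<in> null_sets M" "X \<subseteq> Y" "Y \<subseteq> X \<union> N"
  shows "measure (completion M) X = measure M Y"
proof -
  have "emeasure (completion M) Y \<le> emeasure (completion M) (X \<union> N)"
    using assms by (intro emeasure_mono) auto
  also have "\<dots> = emeasure (completion M) X"
    using assms by (intro emeasure_Un_null_set null_sets_completionI)
  finally have "emeasure (completion M) X = emeasure (completion M) Y"
    using assms by (intro antisym emeasure_mono[OF assms(4)]) auto
  then show ?thesis using assms(2) by (simp add: measure_def)
qed

text \<open>A Lebesgue measurable base is a Borel set plus part of a Borel null set; adding the
  whole null set gives the envelope. Approximating from outside makes the avoided set shrink, the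
  direction needed for \<open>bigraph_interior_iff_borel\<close>.\<close>

lemma conforms_borel_envelope:
  fixes E :: "('n \<times> 'm::finite) set"
  assumes "conforms E A"
  obtains A' N where "borel_family E A'" "\<And>i. N i \<in> null_sets unit_cube"
    "\<And>i. A i \<in> sets (cube UNIV)" "\<And>i. A i \<subseteq> A' i" "\<And>i. A' i \<subseteq> A i \<union> N i"
proof -
  let ?emb = "prod_emb UNIV (\<lambda>_. unit_interval)" and ?P = "\<lambda>i. Pi\<^sub>M (nbhd E i) (\<lambda>_. unit_interval)"
  have "\<exists>A' N. borel_cylinder (nbhd E i) A' \<and> N \<in> null_sets unit_cube \<and>
      A i \<in> sets (cube UNIV) \<and> A i \<subseteq> A' \<and> A' \<subseteq> A i \<union> N" for i
  proof -
    obtain B where B: "B \<in> sets (completion (?P i))" and Ai: "A i = ?emb (nbhd E i) B"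
      using assms by (auto simp: conforms_def cube_def)
    obtain S N N' where S: "B = S \<union> N" "N \<subseteq> N'" "N' \<in> null_sets (?P i)" "S \<in> sets (?P i)"
      using B by (rule sets_completionE)
    have N': "?emb (nbhd E i) N' \<in> null_sets unit_cube"
      using S(3) unit.emeasure_prod_emb[of "nbhd E i" UNIV N']
      by (auto simp: null_sets_def measurable_prod_emb)
    have "?emb (nbhd E i) S \<in> sets unit_cube" using S by (auto simp: measurable_prod_emb)
    moreover have "?emb (nbhd E i) N \<subseteq> ?emb (nbhd E i) N'" using S by (auto simp: prod_emb_def)
    moreover have "A i = ?emb (nbhd E i) S \<union> ?emb (nbhd E i) N" by (simp add: Ai S)
    ultimately have "A i \<in> sets (cube UNIV)"
      unfolding cube_def using N' by (intro sets_completionI)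
    moreover have "borel_cylinder (nbhd E i) (?emb (nbhd E i) (S \<union> N'))"
      using S by (intro borel_cylinder_prod_emb) auto
    moreover have "A i \<subseteq> ?emb (nbhd E i) (S \<union> N')"
      "?emb (nbhd E i) (S \<union> N') \<subseteq> A i \<union> ?emb (nbhd E i) N'"
      using S(2) by (auto simp: Ai S(1) prod_emb_def)
    ultimately show ?thesis using N' by blast
  qed
  then obtain A' N where "\<And>i. borel_cylinder (nbhd E i) (A' i) \<and> N i \<in> null_sets unit_cube \<and>
      A i \<in> sets (cube UNIV) \<and> A i \<subseteq> A' i \<and> A' i \<subseteq> A i \<union> N i"
    by metis
  then show ?thesis by (intro that[of A' N]) (simp_all add: borel_family_def)
qed

lemma borel_family_conforms:
  assumes "borel_family E A"
  shows "conforms E A"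
  unfolding conforms_def
proof
  fix i
  obtain B where "B \<in> sets (Pi\<^sub>M (nbhd E i) (\<lambda>_. unit_interval))"
    "A i = prod_emb UNIV (\<lambda>_. unit_interval) (nbhd E i) B"
    using borel_familyD(1)[OF assms] by (rule borel_cylinderE)
  then show "\<exists>B\<in>sets (cube (nbhd E i)). A i = prod_emb UNIV (\<lambda>_. unit_interval) (nbhd E i) B"
    by (auto simp: cube_def)
qed

lemma measure_cube: "X \<in> sets unit_cube \<Longrightarrow> measure (cube UNIV) X = measure unit_cube X"
  by (simp add: cube_def)

lemma measure_envelope:
  assumes "X \<in> sets (cube UNIV)" "Y \<in> sets unit_cube" "N \<in> null_sets unit_cube" "X \<subseteq> Y" "Y \<subseteq> X \<union> N"
  shows "measure (cube UNIV) X = measure unit_cube Y"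
  using measure_completion_sandwich[OF assms[unfolded cube_def]] by (simp add: cube_def)

lemma has_exclusive_family_iff_borel:
  fixes E :: "('n::finite \<times> 'm::finite) set"
  shows "has_exclusive_family E p \<longleftrightarrow>
    (\<exists>A. borel_family E A \<and> (\<forall>i. measure unit_cube (A i) = p $ i) \<and>
         (\<forall>(i, j)\<in>base_graph E. measure unit_cube (A i \<inter> A j) = 0))"
proof
  assume "has_exclusive_family E p"
  then obtain A where A: "conforms E A" "exclusive E A" "measure_vec A = p"
    by (auto simp: has_exclusive_family_def)
  from A(1) obtain A' N where *: "borel_family E A'" "\<And>i. N i \<in> null_sets unit_cube"
    "\<And>i. A i \<in> sets (cube UNIV)" "\<And>i. A i \<subseteq> A' i" "\<And>i. A' i \<subseteq> A i \<union> N i"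
    using conforms_borel_envelope[OF A(1)] by metis
  note A'[measurable] = borel_familyD(2)[OF *(1)]
  have "measure (cube UNIV) (A i) = measure unit_cube (A' i)" for i
    using * A' by (intro measure_envelope[of _ _ "N i"])
  moreover have "measure (cube UNIV) (A i \<inter> A j) = measure unit_cube (A' i \<inter> A' j)" for i j
    using *(4,5)[of i] *(4,5)[of j] A' *(2,3)
    by (intro measure_envelope[of _ _ "N i \<union> N j"]) auto
  ultimately show "\<exists>A. borel_family E A \<and> (\<forall>i. measure unit_cube (A i) = p $ i) \<and>
         (\<forall>(i, j)\<in>base_graph E. measure unit_cube (A i \<inter> A j) = 0)"
    using A *(1) by (intro exI[of _ A']) (auto simp: exclusive_def measure_vec_def)
next
  assume "\<exists>A. borel_family E A \<and> (\<forall>i. measure unit_cube (A i) = p $ i) \<and>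
         (\<forall>(i, j)\<in>base_graph E. measure unit_cube (A i \<inter> A j) = 0)"
  then obtain A where A: "borel_family E A" "\<And>i. measure unit_cube (A i) = p $ i"
    "\<forall>(i, j)\<in>base_graph E. measure unit_cube (A i \<inter> A j) = 0"
    by blast
  note A'[measurable] = borel_familyD(2)[OF A(1)]
  show "has_exclusive_family E p"
    unfolding has_exclusive_family_def exclusive_def measure_vec_def
    using A borel_family_conforms[OF A(1)]
    by (intro exI[of _ A]) (auto simp: measure_cube vec_eq_iff)
qed

lemma bigraph_interior_iff_borel:
  fixes E :: "('n::finite \<times> 'm::finite) set"
  shows "p \<in> bigraph_interior E \<longleftrightarrow> (\<forall>i. 0 < p $ i \<and> p $ i < 1) \<and>
    (\<forall>A. borel_family E A \<and> (\<forall>i. measure unit_cube (A i) = p $ i) \<longrightarrow>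
         measure unit_cube (avoiding unit_cube A UNIV) > 0)"
    (is "_ \<longleftrightarrow> ?r \<and> ?b")
proof -
  have "(\<forall>A. conforms E A \<and> measure_vec A = p \<longrightarrow>
      measure (cube UNIV) (\<Inter>i. space (cube UNIV) - A i) > 0) \<longleftrightarrow> ?b" (is "?c \<longleftrightarrow> _")
  proof (intro iffI allI impI)
    fix A assume c: ?c and A: "borel_family E A \<and> (\<forall>i. measure unit_cube (A i) = p $ i)"
    then have "measure_vec A = p" "conforms E A"
      using borel_family_conforms borel_familyD(2)[of E A]
      by (auto simp: measure_vec_def measure_cube vec_eq_iff)
    then have "measure (cube UNIV) (\<Inter>i. space (cube UNIV) - A i) > 0" using c by blast
    also have "(\<Inter>i. space (cube UNIV) - A i) = avoiding unit_cube A UNIV"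
      by (auto simp: avoiding_def cube_def)
    also have "measure (cube UNIV) \<dots> = measure unit_cube (avoiding unit_cube A UNIV)"
      using A borel_familyD(2)[of E A] by (intro measure_cube) (auto simp: avoiding_eq)
    finally show "measure unit_cube (avoiding unit_cube A UNIV) > 0" .
  next
    fix A assume b: ?b and "conforms E A \<and> measure_vec A = p"
    then have A: "conforms E A" "measure_vec A = p" by auto
    from A(1) obtain A' N where *: "borel_family E A'" "\<And>i. N i \<in> null_sets unit_cube"
      "\<And>i. A i \<in> sets (cube UNIV)" "\<And>i. A i \<subseteq> A' i" "\<And>i. A' i \<subseteq> A i \<union> N i"
      using conforms_borel_envelope[OF A(1)] by metis
    note A' = borel_familyD(2)[OF *(1)]
    have "measure (cube UNIV) (A i) = measure unit_cube (A' i)" for i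
      using * A' by (intro measure_envelope[of _ _ "N i"])
    then have "0 < measure unit_cube (avoiding unit_cube A' UNIV)"
      using b A(2) *(1) by (auto simp: measure_vec_def)
    also have "\<dots> = measure (cube UNIV) (avoiding unit_cube A' UNIV)"
      using A' by (intro measure_cube[symmetric]) (auto simp: avoiding_eq)
    also have "\<dots> \<le> measure (cube UNIV) (\<Inter>i. space (cube UNIV) - A i)"
    proof -
      interpret prob_space "cube UNIV"
        unfolding cube_def by (intro prob_space.prob_space_completion prob_space_PiM prob_space_unit_interval)
      show ?thesis
        using *(3,4) by (intro finite_measure_mono sets.finite_INT) (auto simp: avoiding_def cube_def)
    qed
    finally show "0 < measure (cube UNIV) (\<Inter>i. space (cube UNIV) - A i)" .
  qed
  then show ?thesis by (simp add: bigraph_interior_def)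
qed

section \<open>Cylinders of prescribed measure\<close>

text \<open>Cutting \<open>X\<close> at \<open>x j \<le> t\<close> keeps it a cylinder over
  \<open>J\<close> because \<open>j \<in> J\<close>. The remaining measure is a 1-Lipschitz function
  of \<open>t\<close>, and the intermediate value theorem applies.\<close>

lemma borel_cylinder_subset_measure:
  fixes j :: "'m::finite"
  assumes X: "borel_cylinder J X" and j: "j \<in> J" and c: "0 \<le> c" "c \<le> measure unit_cube X"
  obtains Y where "borel_cylinder J Y" "Y \<subseteq> X" "measure unit_cube Y = c"
proof -
  let ?H = "\<lambda>I. {x \<in> space unit_cube. x j \<in> I}"
  let ?h = "\<lambda>t. measure unit_cube (X \<inter> ?H {..t})"
  have cyl: "borel_cylinder J (X \<inter> ?H I)" if "I \<in> sets borel" for I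
    using X borel_cylinder_coordinate[OF j that] by (rule borel_cylinder_Int)
  note Xs = borel_cylinder_sets[OF X]
  have Hs: "?H I \<in> sets unit_cube" if "I \<in> sets borel" for I
    by (rule borel_cylinder_sets[OF borel_cylinder_coordinate[OF j that]])
  have XH: "X \<inter> ?H I \<in> sets unit_cube" if "I \<in> sets borel" for I
    using Xs Hs[OF that] by (rule sets.Int)
  have len: "measure unit_cube (?H {s<..t}) \<le> t - s" if "s \<le> t" for s t
  proof -
    have "?H {s<..t} = {x \<in> space unit_cube. x j \<in> {s<..t} \<inter> {0..1}}" by (auto simp: space_unit_cube)
    then have "emeasure unit_cube (?H {s<..t}) = emeasure unit_interval ({s<..t} \<inter> {0..1})"
      using unit.emeasure_PiM_Collect_single[of j UNIV "{s<..t} \<inter> {0..1}"]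
      by (simp add: sets_unit_interval_iff)
    also have "\<dots> \<le> emeasure lborel {s<..t}"
      by (subst emeasure_unit_interval) (auto intro: emeasure_mono)
    finally show ?thesis using that by (simp add: unit.P.emeasure_eq_measure)
  qed
  have lip: "\<bar>?h t - ?h s\<bar> \<le> \<bar>t - s\<bar>" for s t
  proof -
    have *: "?h s \<le> ?h t \<and> ?h t \<le> ?h s + (t - s)" if "s \<le> t" for s t
    proof
      show "?h s \<le> ?h t" using that by (intro unit.P.finite_measure_mono XH) auto
      have "?h t \<le> measure unit_cube (X \<inter> ?H {..s} \<union> ?H {s<..t})"
        by (intro unit.P.finite_measure_mono sets.Un XH Hs) auto
      also have "\<dots> \<le> ?h s + measure unit_cube (?H {s<..t})"
        by (intro measure_Un_le XH Hs) auto
      finally show "?h t \<le> ?h s + (t - s)" using len[OF that] by simp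
    qed
    show ?thesis using *[of s t] *[of t s] by (cases "s \<le> t") auto
  qed
  have cont: "continuous_on {0..1} ?h"
  proof (rule continuous_onI)
    fix x e :: real assume "0 < e"
    moreover have "dist (?h x') (?h x) \<le> e" if "dist x' x < e" for x'
      using lip[of x' x] that unfolding dist_real_def by linarith
    ultimately show "\<exists>d>0. \<forall>x'\<in>{0..1}. dist x' x < d \<longrightarrow> dist (?h x') (?h x) \<le> e"
      by blast
  qed
  \<comment> \<open>The cut at 0 is null without computing the measure of a hyperplane: the cut at
    \<open>- e\<close> is empty, and the Lipschitz bound compares the two.\<close>
  have "?h 0 \<le> c"
  proof -
    have "?h 0 \<le> 0 + e" if "e > 0" for e
    proof -
      have "- e < x j" if "x \<in> space unit_cube" for x
        using that \<open>e > 0\<close> by (auto simp: space_unit_cube intro: less_le_trans[of _ 0])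
      then have "X \<inter> ?H {..- e} = {}" by force
      then have "?h (- e) = 0" by (simp only: measure_empty)
      then show ?thesis using lip[of 0 "- e"] that by linarith
    qed
    then have "?h 0 \<le> 0" by (rule field_le_epsilon)
    then show ?thesis using c by simp
  qed
  moreover have "X \<inter> ?H {..1} = X"
    using sets.sets_into_space[OF Xs] by (auto simp: space_unit_cube)
  then have "c \<le> ?h 1" using c by simp
  ultimately obtain t where "?h t = c" using IVT'[OF _ _ _ cont, of c] by auto
  then show ?thesis using cyl[of "{..t}"] by (intro that[of "X \<inter> ?H {..t}"]) auto
qed

lemma borel_cylinder_superset_measure:
  fixes j :: "'m::finite"
  assumes X: "borel_cylinder J X" and j: "j \<in> J" and c: "measure unit_cube X \<le> c" "c \<le> 1"
  obtains Y where "borel_cylinder J Y" "X \<subseteq> Y" "measure unit_cube Y = c"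
proof -
  let ?C = "\<lambda>X. space unit_cube - X"
  have X': "X \<in> sets unit_cube" using borel_cylinder_sets[OF X] .
  obtain Y where Y: "borel_cylinder J Y" "Y \<subseteq> ?C X" "measure unit_cube Y = 1 - c"
    using c X' by (metis borel_cylinder_subset_measure[OF borel_cylinder_Compl[OF X] j, of "1 - c"]
        unit.P.prob_compl diff_ge_0_iff_ge diff_left_mono)
  have "Y \<in> sets unit_cube" using borel_cylinder_sets[OF Y(1)] .
  then have "measure unit_cube (?C Y) = c" using Y by (simp add: unit.P.prob_compl)
  moreover have "X \<subseteq> ?C Y" using Y(2) sets.sets_into_space[OF X'] by auto
  ultimately show ?thesis using borel_cylinder_Compl[OF Y(1)] by (intro that)
qed

subsection \<open>Interior and boundary\<close>

lemma sym_base_graph: "sym (base_graph E)" and irrefl_base_graph: "irrefl (base_graph E)"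
  by (auto simp: base_graph_def sym_def irrefl_def)

lemma prob_space_unit_cube: "prob_space unit_cube"
  by (intro prob_space_PiM prob_space_unit_interval)

lemma abstract_interior_subset_bigraph_interior:
  fixes E :: "('n::finite \<times> 'm::finite) set"
  assumes p: "p \<in> abstract_interior (base_graph E)"
  shows "p \<in> bigraph_interior E"
  unfolding bigraph_interior_iff_borel
proof (intro conjI allI impI)
  show "0 < p $ i" "p $ i < 1" for i using p by (auto simp: abstract_interior_def)
  fix A assume A: "borel_family E A \<and> (\<forall>i. measure unit_cube (A i) = p $ i)"
  then have "measure unit_cube (\<Inter>i. space unit_cube - A i) > 0"
    by (intro abstract_interiorD[OF p prob_space_unit_cube] borel_family_dependency_graph)
      (auto intro: borel_familyD)
  also have "(\<Inter>i. space unit_cube - A i) = avoiding unit_cube A UNIV"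
    by (auto simp: avoiding_def)
  finally show "measure unit_cube (avoiding unit_cube A UNIV) > 0" .
qed

text \<open>A family for the smaller vector is enlarged within the same coordinates to one for the
  larger vector, and this only shrinks the avoided set.\<close>

lemma bigraph_interior_scale_down:
  fixes E :: "('n::finite \<times> 'm::finite) set"
  assumes nb: "\<forall>i. nbhd E i \<noteq> {}" and p: "\<forall>i. 0 < p $ i"
    and l: "l *\<^sub>R p \<in> bigraph_interior E" "0 < k" "k \<le> l"
  shows "k *\<^sub>R p \<in> bigraph_interior E"
  unfolding bigraph_interior_iff_borel
proof (intro conjI allI impI)
  have lp: "l * p $ i < 1" "k * p $ i \<le> l * p $ i" for i
    using l p by (auto simp: bigraph_interior_def intro: mult_right_mono less_imp_le)
  show "(k *\<^sub>R p) $ i < 1" for i using lp[of i] by (simp add: le_less_trans)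
  show "0 < (k *\<^sub>R p) $ i" for i using p l by simp
  fix A assume "borel_family E A \<and> (\<forall>i. measure unit_cube (A i) = (k *\<^sub>R p) $ i)"
  then have A: "borel_family E A" "\<And>i. measure unit_cube (A i) = k * p $ i" by auto
  have "\<exists>Y. borel_cylinder (nbhd E i) Y \<and> A i \<subseteq> Y \<and> measure unit_cube Y = l * p $ i" for i
  proof -
    obtain j where "j \<in> nbhd E i" using nb by auto
    from borel_cylinder_superset_measure[OF borel_familyD(1)[OF A(1), of i] this, of "l * p $ i"]
    show ?thesis using lp[of i] A(2)[of i] by (metis less_imp_le)
  qed
  then obtain Y where Y: "\<And>i. borel_cylinder (nbhd E i) (Y i)" "\<And>i. A i \<subseteq> Y i"
    "\<And>i. measure unit_cube (Y i) = l * p $ i"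
    by metis
  then have "0 < measure unit_cube (avoiding unit_cube Y UNIV)"
    using l(1) by (simp add: bigraph_interior_iff_borel borel_family_def)
  also have "\<dots> \<le> measure unit_cube (avoiding unit_cube A UNIV)"
    using Y(2) borel_familyD(2)[OF A(1)]
    by (intro unit.P.finite_measure_mono) (auto simp: avoiding_def avoiding_eq)
  finally show "0 < measure unit_cube (avoiding unit_cube A UNIV)" .
qed

text \<open>Passing to smaller cylinders over the same coordinates preserves null
  intersections.\<close>

lemma has_exclusive_family_scale_down:
  fixes E :: "('n::finite \<times> 'm::finite) set"
  assumes nb: "\<forall>i. nbhd E i \<noteq> {}" and p: "\<forall>i. 0 < p $ i"
    and l: "has_exclusive_family E (l *\<^sub>R p)" "0 < k" "k \<le> l"
  shows "has_exclusive_family E (k *\<^sub>R p)"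
proof -
  obtain A where A: "borel_family E A" "\<And>i. measure unit_cube (A i) = l * p $ i"
    "\<forall>(i, j)\<in>base_graph E. measure unit_cube (A i \<inter> A j) = 0"
    using l(1) by (auto simp: has_exclusive_family_iff_borel)
  have "\<exists>Y. borel_cylinder (nbhd E i) Y \<and> Y \<subseteq> A i \<and> measure unit_cube Y = k * p $ i" for i
  proof -
    have "0 \<le> k * p $ i" "k * p $ i \<le> l * p $ i"
      using l p by (auto intro: mult_right_mono less_imp_le)
    moreover obtain j where "j \<in> nbhd E i" using nb by auto
    ultimately show ?thesis
      using borel_cylinder_subset_measure[OF borel_familyD(1)[OF A(1), of i], of j "k * p $ i"] A(2)[of i]
      by metis
  qed
  then obtain Y where Y: "\<And>i. borel_cylinder (nbhd E i) (Y i)" "\<And>i. Y i \<subseteq> A i"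
    "\<And>i. measure unit_cube (Y i) = k * p $ i"
    by metis
  have "measure unit_cube (Y i \<inter> Y j) = 0" if "(i, j) \<in> base_graph E" for i j
  proof -
    have "measure unit_cube (Y i \<inter> Y j) \<le> measure unit_cube (A i \<inter> A j)"
      using Y(2)[of i] Y(2)[of j] borel_familyD(2)[OF A(1)]
      by (intro unit.P.finite_measure_mono) auto
    moreover have "measure unit_cube (A i \<inter> A j) = 0" using A(3) that by auto
    ultimately show ?thesis using measure_nonneg[of unit_cube "Y i \<inter> Y j"] by linarith
  qed
  then show ?thesis
    using Y unfolding has_exclusive_family_iff_borel by (intro exI[of _ Y]) (auto simp: borel_family_def)
qed

lemma ex_small_interior:
  fixes E :: "('n::finite \<times> 'm::finite) set"
  assumes p: "\<forall>i. 0 < p $ i"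
  shows "\<exists>l>0. l *\<^sub>R p \<in> bigraph_interior E"
proof (intro exI conjI)
  \<comment> \<open>The union bound decides the scale: the additional 1 makes the total of the
    scaled measures strictly less than 1.\<close>
  let ?s = "1 + (\<Sum>i\<in>UNIV. p $ i)"
  have s: "0 < ?s" using p by (intro add_pos_nonneg sum_nonneg) (auto intro: less_imp_le)
  then show "0 < 1 / ?s" by simp
  have ps: "p $ i < ?s" for i
  proof -
    have "p $ i \<le> (\<Sum>i\<in>UNIV. p $ i)" using p by (intro member_le_sum) (auto intro: less_imp_le)
    then show ?thesis by simp
  qed
  show "(1 / ?s) *\<^sub>R p \<in> bigraph_interior E"
    unfolding bigraph_interior_iff_borel
  proof (intro conjI allI impI)
    show "0 < ((1 / ?s) *\<^sub>R p) $ i" "((1 / ?s) *\<^sub>R p) $ i < 1" for i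
      using s ps[of i] p by auto
    fix A assume A: "borel_family E A \<and> (\<forall>i. measure unit_cube (A i) = ((1 / ?s) *\<^sub>R p) $ i)"
    have sets: "A i \<in> sets unit_cube" for i using A by (auto intro: borel_familyD)
    have "measure unit_cube (\<Union>i. A i) \<le> (\<Sum>i\<in>UNIV. measure unit_cube (A i))"
      using sets by (intro measure_UNION_le) auto
    also have "\<dots> = (\<Sum>i\<in>UNIV. p $ i) / ?s" using A by (simp add: sum_divide_distrib)
    also have "\<dots> < 1" using s by simp
    finally show "0 < measure unit_cube (avoiding unit_cube A UNIV)"
      using sets unfolding avoiding_eq by (subst unit.P.prob_compl) auto
  qed
qed

text \<open>The scale is the supremum of those in the interior, which are downward closed by
  \<open>bigraph_interior_scale_down\<close>. The last conclusion lets any interior scale be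
  compared with this one without proving uniqueness.\<close>

lemma ex_boundary:
  fixes E :: "('n::finite \<times> 'm::finite) set"
  assumes nb: "\<forall>i. nbhd E i \<noteq> {}" and p: "\<forall>i. 0 < p $ i"
  obtains l where "0 < l" "l *\<^sub>R p \<in> bigraph_boundary E"
    "\<And>k. 0 < k \<Longrightarrow> k *\<^sub>R p \<in> bigraph_interior E \<Longrightarrow> k \<le> l"
proof
  let ?S = "{l. 0 < l \<and> l *\<^sub>R p \<in> bigraph_interior E}"
  let ?l = "Sup ?S"
  obtain l0 where l0: "l0 \<in> ?S" using ex_small_interior[OF p, of E] by auto
  have ub: "k \<le> 1 / p $ i" if "k \<in> ?S" for k i
    using that p by (auto simp: bigraph_interior_def field_simps intro: less_imp_le)
  have bdd: "bdd_above ?S" using ub by (intro bdd_aboveI) blast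
  show le: "k \<le> ?l" if "0 < k" "k *\<^sub>R p \<in> bigraph_interior E" for k
    using that by (intro cSup_upper bdd) auto
  show pos: "0 < ?l" using l0 le[of l0] by auto
  have "?l \<le> 1 / p $ i" for i using l0 ub by (intro cSup_least) auto
  then have "?l * p $ i \<le> 1" for i using p by (simp add: field_simps)
  moreover have "((1 - \<epsilon>) * ?l) *\<^sub>R p \<in> bigraph_interior E" if "0 < \<epsilon>" "\<epsilon> < 1" for \<epsilon>
  proof -
    have "(1 - \<epsilon>) * ?l < ?l" using pos that by simp
    moreover have "?S \<noteq> {}" using l0 by blast
    ultimately have "\<exists>k\<in>?S. (1 - \<epsilon>) * ?l < k" using bdd by (subst (asm) less_cSup_iff) auto
    then obtain k where k: "k *\<^sub>R p \<in> bigraph_interior E" "(1 - \<epsilon>) * ?l < k" by blast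
    have "0 < (1 - \<epsilon>) * ?l" using that pos by simp
    then show ?thesis by (rule bigraph_interior_scale_down[OF nb p k(1) _ less_imp_le[OF k(2)]])
  qed
  moreover have "((1 + \<epsilon>) * ?l) *\<^sub>R p \<notin> bigraph_interior E" if "0 < \<epsilon>" for \<epsilon>
  proof
    assume "((1 + \<epsilon>) * ?l) *\<^sub>R p \<in> bigraph_interior E"
    then have "(1 + \<epsilon>) * ?l \<le> ?l" using that pos by (intro le) auto
    moreover have "0 < \<epsilon> * ?l" using that pos by simp
    ultimately show False by (simp add: algebra_simps)
  qed
  ultimately show "?l *\<^sub>R p \<in> bigraph_boundary E" using pos p by (simp add: bigraph_boundary_def)
qed

text \<open>The exclusive family satisfies the recursion with equality, so it can play the extremal
  part in \<open>shearer_ratio_mono\<close>. Comparing \<open>{}\<close> with \<open>UNIV\<close>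
  shows that any other family avoids its events with at least the same positive probability.\<close>

lemma abstract_interior_if_exclusive:
  fixes E :: "('n::finite \<times> 'm::finite) set"
  assumes p: "p \<in> bigraph_interior E" and ex: "has_exclusive_family E p"
  shows "p \<in> abstract_interior (base_graph E)"
proof -
  let ?G = "base_graph E"
  have p01: "0 < p $ i" "p $ i < 1" for i using p by (auto simp: bigraph_interior_def)
  obtain X where X: "borel_family E X" "\<And>i. measure unit_cube (X i) = p $ i"
    "\<And>i j. (i, j) \<in> ?G \<Longrightarrow> measure unit_cube (X i \<inter> X j) = 0"
    using ex unfolding has_exclusive_family_iff_borel by blast
  note Xs = borel_familyD(2)[OF X(1)]
  note Xdep = borel_family_dependency_graph[OF X(1)]
  let ?I = "\<lambda>S. measure unit_cube (avoiding unit_cube X S)"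
  have IU: "0 < ?I UNIV" using p X by (simp add: bigraph_interior_iff_borel)
  have "?I UNIV \<le> ?I S" for S
    using Xs by (intro unit.P.finite_measure_mono) (auto simp: avoiding_def avoiding_eq)
  then have Ipos: "0 < ?I S" for S using IU by (meson less_le_trans)
  have "measure M (\<Inter>i. space M - A i) > 0"
    if "prob_space M" and A: "\<And>i. A i \<in> sets M" "\<And>i. measure M (A i) = p $ i" "dependency_graph M ?G A"
    for M :: "real measure" and A
  proof -
    interpret prob_space M by (rule that(1))
    let ?P = "\<lambda>S. measure M (avoiding M A S)"
    have "?P {} * ?I UNIV \<le> ?P UNIV * ?I {}"
      by (rule shearer_ratio_mono[where q = "($) p" and G = ?G])
        (use avoiding_rec_eq[OF prob_space_unit_cube Xs X(2) Xdep _ X(3)]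
          avoiding_rec_ge[OF that] p01 Ipos IU in \<open>auto intro: less_imp_le\<close>)
    also have "?P {} = 1" by (simp add: avoiding_def prob_space)
    also have "?I {} = 1" by (simp add: avoiding_def unit.P.prob_space)
    finally have "0 < ?P UNIV" using IU by simp
    also have "avoiding M A UNIV = (\<Inter>i. space M - A i)" by (auto simp: avoiding_def)
    finally show ?thesis .
  qed
  then show ?thesis using p01 by (auto simp: abstract_interior_def)
qed

subsection \<open>Discretising the variables\<close>

text \<open>A mean outside the closed convex set would be strictly separated from it by a
  hyperplane, and integrating the linear functional contradicts this. Restricting to points with
  \<open>P\<close> is harmless as they have full measure.\<close>

lemma expectation_in_closure_convex_hull:
  fixes g :: "'a \<Rightarrow> real ^ 'n::finite"
  assumes N: "prob_space N" and int: "\<And>i. integrable N (\<lambda>x. g x $ i)" and P: "AE x in N. P x"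
  shows "(\<chi> i. \<integral>x. g x $ i \<partial>N) \<in> closure (convex hull (g ` {x \<in> space N. P x}))" (is "?z \<in> ?C")
proof (rule ccontr)
  interpret prob_space N by (rule N)
  assume "?z \<notin> ?C"
  then obtain a b where ab: "a \<bullet> ?z < b" "\<forall>x\<in>?C. b < a \<bullet> x"
    using separating_hyperplane_closed_point[of ?C ?z] by (auto simp: convex_closure)
  have "b \<le> (\<integral>x. a \<bullet> g x \<partial>N)"
  proof (rule integral_ge_const)
    show "integrable N (\<lambda>x. a \<bullet> g x)" by (simp add: inner_vec_def int)
    have *: "b \<le> a \<bullet> g x" if "x \<in> space N" "P x" for x
    proof -
      have "g x \<in> convex hull (g ` {x \<in> space N. P x})" using that by (intro hull_inc) auto
      then show ?thesis using ab(2) closure_subset by (blast intro: less_imp_le)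
    qed
    show "AE x in N. b \<le> a \<bullet> g x" by (rule AE_mp[OF P AE_I2]) (simp add: *)
  qed
  also have "(\<integral>x. a \<bullet> g x \<partial>N) = a \<bullet> ?z" by (simp add: inner_vec_def int)
  finally show False using ab(1) by simp
qed

text \<open>By Caratheodory's theorem \<open>CARD('n) + 1\<close> atoms suffice; they are indexed by \<open>'n option\<close>.\<close>

lemma approximate_expectation_finite_support:
  fixes g :: "'a \<Rightarrow> real ^ 'n::finite"
  assumes N: "prob_space N" and int: "\<And>i. integrable N (\<lambda>x. g x $ i)" and P: "AE x in N. P x"
    and d: "0 < d"
  obtains y and r :: "'n option pmf" where "\<And>l. y l \<in> space N" "\<And>l. P (y l)"
    "\<And>i. \<bar>(\<Sum>l\<in>UNIV. pmf r l * g (y l) $ i) - (\<integral>x. g x $ i \<partial>N)\<bar> < d"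
proof -
  interpret prob_space N by (rule N)
  let ?S = "{x \<in> space N. P x}"
  obtain w where w: "w \<in> convex hull (g ` ?S)" "dist w (\<chi> i. \<integral>x. g x $ i \<partial>N) < d"
    using expectation_in_closure_convex_hull[OF N int P] d by (auto simp: closure_approachable)
  obtain T u where T: "finite T" "T \<subseteq> g ` ?S" "card T \<le> DIM(real ^ 'n) + 1"
    "\<forall>x\<in>T. 0 \<le> u x" "sum u T = 1" "(\<Sum>v\<in>T. u v *\<^sub>R v) = w"
    using w(1) unfolding convex_hull_caratheodory by blast
  have "card T \<le> card (UNIV :: 'n option set)" using T(3) by (simp add: card_UNIV_option)
  then obtain h :: "real ^ 'n \<Rightarrow> 'n option" where h: "inj_on h T"
    using card_le_inj[OF T(1) finite] by blast
  have "T \<noteq> {}" using T(5) by auto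
  then obtain x0 where x0: "x0 \<in> ?S" using T(2) by auto
  have "\<forall>v\<in>T. \<exists>x\<in>?S. g x = v" using T(2) by auto
  then obtain s where s: "\<And>v. v \<in> T \<Longrightarrow> s v \<in> ?S \<and> g (s v) = v" by metis
  define y where "y l = (if l \<in> h ` T then s (the_inv_into T h l) else x0)" for l
  define c where "c l = (if l \<in> h ` T then u (the_inv_into T h l) else 0)" for l
  have yh: "y (h v) = s v" "c (h v) = u v" if "v \<in> T" for v
    using that by (auto simp: y_def c_def the_inv_into_f_f[OF h])
  have yS: "y l \<in> ?S" for l
  proof (cases "l \<in> h ` T")
    case True
    then show ?thesis using s yh by auto
  qed (use x0 in \<open>simp add: y_def\<close>)
  have c0: "0 \<le> c l" for l
  proof (cases "l \<in> h ` T")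
    case True
    then show ?thesis using T(4) yh by auto
  qed (simp add: c_def)
  have sum_c: "(\<Sum>l\<in>UNIV. c l * f l) = (\<Sum>v\<in>T. u v * f (h v))" for f :: "'n option \<Rightarrow> real"
  proof -
    have "(\<Sum>l\<in>UNIV. c l * f l) = (\<Sum>l\<in>h ` T. c l * f l)"
      by (rule sum.mono_neutral_right) (auto simp: c_def)
    also have "\<dots> = (\<Sum>v\<in>T. c (h v) * f (h v))" using h by (simp add: sum.reindex)
    finally show ?thesis using yh by simp
  qed
  have "(\<Sum>l\<in>UNIV. c l) = 1" using sum_c[of "\<lambda>_. 1"] T(5) by simp
  then have "(\<integral>\<^sup>+ l. ennreal (c l) \<partial>count_space UNIV) = 1"
    by (simp add: nn_integral_count_space_finite c0 flip: ennreal_1)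
  then have pmf: "pmf (embed_pmf c) l = c l" for l by (intro pmf_embed_pmf c0)
  have "(\<Sum>l\<in>UNIV. pmf (embed_pmf c) l * g (y l) $ i) = w $ i" for i
    using sum_c[of "\<lambda>l. g (y l) $ i"] s by (simp add: pmf yh flip: T(6))
  moreover have "\<bar>w $ i - (\<integral>x. g x $ i \<partial>N)\<bar> < d" for i
    using component_le_norm_cart[of "w - (\<chi> i. \<integral>x. g x $ i \<partial>N)" i] w(2)
    by (simp add: dist_norm)
  ultimately show ?thesis using yS by (intro that[of y "embed_pmf c"]) auto
qed

definition slice :: "('m \<Rightarrow> 'a measure) \<Rightarrow> 'm \<Rightarrow> ('m \<Rightarrow> 'a) set \<Rightarrow> 'a \<Rightarrow> ('m \<Rightarrow> 'a) set" where
  "slice M j X y = {x \<in> space (Pi\<^sub>M (UNIV - {j}) M). x(j := y) \<in> X}"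

lemma
  fixes M :: "'m::finite \<Rightarrow> 'a measure"
  assumes M: "\<And>j. prob_space (M j)" and X: "X \<in> sets (Pi\<^sub>M UNIV M)"
  shows slice_measurable: "(\<lambda>y. measure (Pi\<^sub>M (UNIV - {j}) M) (slice M j X y)) \<in> borel_measurable (M j)"
    and measure_PiM_slice:
      "measure (Pi\<^sub>M UNIV M) X = (\<integral>y. measure (Pi\<^sub>M (UNIV - {j}) M) (slice M j X y) \<partial>M j)"
proof -
  let ?P = "Pi\<^sub>M (UNIV - {j}) M"
  interpret product_prob_space M by (rule product_prob_spaceI) (rule M)
  interpret Q: prob_space ?P by (intro prob_space_PiM M)
  interpret PX: prob_space "Pi\<^sub>M UNIV M" by (intro prob_space_PiM M)
  have ins: "insert j (UNIV - {j}) = UNIV" by auto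
  have upd: "(\<lambda>(f, y). f(j := y)) \<in> measurable (?P \<Otimes>\<^sub>M M j) (Pi\<^sub>M UNIV M)"
    using measurable_add_dim[of j "UNIV - {j}" M] by (simp only: ins)
  have [measurable]: "X \<in> sets (Pi\<^sub>M UNIV M)" by (rule X)
  have upd1: "(\<lambda>x. x(j := y)) \<in> measurable ?P (Pi\<^sub>M UNIV M)" if "y \<in> space (M j)" for y
    using measurable_compose[OF measurable_Pair2'[OF that] upd] by simp
  have slice_sets: "slice M j X y \<in> sets ?P" if "y \<in> space (M j)" for y
    using measurable_sets[OF upd1[OF that] X] by (simp add: slice_def vimage_def Int_def conj_commute)
  let ?f = "\<lambda>y. \<integral>\<^sup>+ x. indicator X (x(j := y)) \<partial>?P"
  have f: "?f y = ennreal (measure ?P (slice M j X y))" if "y \<in> space (M j)" for y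
  proof -
    have "?f y = (\<integral>\<^sup>+ x. indicator (slice M j X y) x \<partial>?P)"
      by (intro nn_integral_cong) (auto simp: slice_def indicator_def)
    then show ?thesis using slice_sets[OF that] by (simp add: Q.emeasure_eq_measure)
  qed
  have "(\<lambda>(y, x). indicator X (x(j := y)) :: ennreal) \<in> borel_measurable (M j \<Otimes>\<^sub>M ?P)"
  proof -
    have "(\<lambda>(y, x). x(j := y)) \<in> measurable (M j \<Otimes>\<^sub>M ?P) (Pi\<^sub>M UNIV M)"
      using measurable_compose[OF measurable_pair_swap' upd] by (simp add: split_beta')
    from measurable_compose[OF this borel_measurable_indicator[OF X]]
    show ?thesis by (simp add: split_beta')
  qed
  then have fm: "?f \<in> borel_measurable (M j)" by (rule Q.borel_measurable_nn_integral)
  have "(\<lambda>y. enn2real (?f y)) \<in> borel_measurable (M j)" using fm by measurable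
  then show sm: "(\<lambda>y. measure ?P (slice M j X y)) \<in> borel_measurable (M j)"
    by (rule measurable_cong[THEN iffD1, rotated]) (simp add: f)
  have "emeasure (Pi\<^sub>M UNIV M) X = (\<integral>\<^sup>+ x. indicator X x \<partial>Pi\<^sub>M (insert j (UNIV - {j})) M)"
    using X by (simp only: ins nn_integral_indicator)
  also have "\<dots> = (\<integral>\<^sup>+ y. ?f y \<partial>M j)"
    by (rule product_nn_integral_insert_rev) (simp_all only: ins, use X in auto)
  also have "\<dots> = (\<integral>\<^sup>+ y. ennreal (measure ?P (slice M j X y)) \<partial>M j)"
    by (rule nn_integral_cong) (rule f)
  also have "\<dots> = ennreal (\<integral>y. measure ?P (slice M j X y) \<partial>M j)"
    by (intro nn_integral_eq_integral M.integrable_const_bound[where B = 1] sm) auto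
  finally show "measure (Pi\<^sub>M UNIV M) X = (\<integral>y. measure ?P (slice M j X y) \<partial>M j)"
    by (simp add: PX.emeasure_eq_measure ennreal_inj integral_nonneg)
qed

text \<open>Each measure is the mean, over coordinate \<open>j\<close>, of slice measures, so the
  finite-support approximation applies to their vector. Almost every slice of \<open>C\<close> is
  null; choosing the atoms among those values keeps \<open>C\<close> exactly null, not merely small.
  Only the law of the coordinate changes, while space, sigma-algebra and events stay, so the step
  can be repeated.\<close>

lemma discretise_coordinate:
  fixes M :: "'m::finite \<Rightarrow> 'a measure" and A :: "'n::finite \<Rightarrow> ('m \<Rightarrow> 'a) set"
  assumes M: "\<And>j. prob_space (M j)" and A: "\<And>i. A i \<in> sets (Pi\<^sub>M UNIV M)"
    and C: "C \<in> sets (Pi\<^sub>M UNIV M)" "measure (Pi\<^sub>M UNIV M) C = 0" and d: "0 < d"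
  obtains y and r :: "'n option pmf" where "\<And>l. y l \<in> space (M j)"
    "\<And>i. \<bar>measure (Pi\<^sub>M UNIV (M(j := distr r (M j) y))) (A i) - measure (Pi\<^sub>M UNIV M) (A i)\<bar> < d"
    "measure (Pi\<^sub>M UNIV (M(j := distr r (M j) y))) C = 0"
proof -
  interpret Mj: prob_space "M j" by (rule M)
  let ?P = "Pi\<^sub>M (UNIV - {j}) M"
  interpret P: prob_space ?P by (intro prob_space_PiM M)
  let ?g = "\<lambda>X y. measure ?P (slice M j X y)"
  have int: "integrable (M j) (?g X)" if "X \<in> sets (Pi\<^sub>M UNIV M)" for X
    by (intro Mj.integrable_const_bound[where B = 1] slice_measurable[OF M that]) auto
  have "AE y in M j. ?g C y = 0"
    using C(2) int[OF C(1)] unfolding measure_PiM_slice[OF M C(1), of j]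
    by (subst (asm) integral_nonneg_eq_0_iff_AE) auto
  note AE = this
  have int': "integrable (M j) (\<lambda>y. (\<chi> i. ?g (A i) y) $ i)" for i using int[OF A] by simp
  obtain r :: "'n option pmf" and y
    where y: "\<And>l. y l \<in> space (M j)" "\<And>l. ?g C (y l) = 0"
      and r: "\<And>i. \<bar>(\<Sum>l\<in>UNIV. pmf r l * (\<chi> i. ?g (A i) (y l)) $ i) -
        (\<integral>x. (\<chi> i. ?g (A i) x) $ i \<partial>M j)\<bar> < d"
    by (rule approximate_expectation_finite_support[OF M int' AE d]) (rule that, simp_all)
  let ?D = "distr (measure_pmf r) (M j) y"
  let ?M = "M(j := ?D)"
  have ym: "y \<in> measurable (measure_pmf r) (M j)" using y(1) by simp
  have M': "prob_space (?M k)" for k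
    using M[of k] measure_pmf.prob_space_distr[OF ym] by simp
  have sets: "sets (Pi\<^sub>M UNIV ?M) = sets (Pi\<^sub>M UNIV M)" by (intro sets_PiM_cong) auto
  have P': "Pi\<^sub>M (UNIV - {j}) ?M = ?P" by (intro PiM_cong) auto
  have eq: "measure (Pi\<^sub>M UNIV ?M) X = (\<Sum>l\<in>UNIV. pmf r l * ?g X (y l))"
    if X: "X \<in> sets (Pi\<^sub>M UNIV M)" for X
  proof -
    have "slice ?M j X = slice M j X" by (simp add: slice_def fun_eq_iff P')
    then have "measure (Pi\<^sub>M UNIV ?M) X = (\<integral>y. ?g X y \<partial>?D)"
      using measure_PiM_slice[of ?M X j, OF M'] X by (simp add: sets P')
    also have "\<dots> = (\<integral>l. ?g X (y l) \<partial>measure_pmf r)"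
      by (intro integral_distr ym slice_measurable[OF M X])
    also have "\<dots> = (\<Sum>l\<in>UNIV. ?g X (y l) * pmf r l)" by (rule integral_measure_pmf_real) auto
    finally show ?thesis by (simp add: mult.commute)
  qed
  show ?thesis
  proof (rule that[of y r])
    show "\<bar>measure (Pi\<^sub>M UNIV ?M) (A i) - measure (Pi\<^sub>M UNIV M) (A i)\<bar> < d" for i
      using r[of i] by (simp add: eq[OF A] measure_PiM_slice[OF M A, where j = j])
  qed (simp_all add: y eq[OF C(1)])
qed

text \<open>The coordinates are replaced one at a time, half of the error being reserved for the
  newest one. Values \<open>y j\<close> for coordinates outside \<open>J\<close> are arbitrary
  points of the space.\<close>

lemma discretise_coordinates:
  fixes M :: "'m::finite \<Rightarrow> 'a measure" and A :: "'n::finite \<Rightarrow> ('m \<Rightarrow> 'a) set"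
  assumes M: "\<And>j. prob_space (M j)" and A: "\<And>i. A i \<in> sets (Pi\<^sub>M UNIV M)"
    and C: "C \<in> sets (Pi\<^sub>M UNIV M)" "measure (Pi\<^sub>M UNIV M) C = 0" and d: "0 < d"
  shows "\<exists>(r :: 'm \<Rightarrow> 'n option pmf) y. (\<forall>j l. y j l \<in> space (M j)) \<and>
    (\<forall>i. \<bar>measure (Pi\<^sub>M UNIV (\<lambda>j. if j \<in> J then distr (r j) (M j) (y j) else M j)) (A i)
          - measure (Pi\<^sub>M UNIV M) (A i)\<bar> < d) \<and>
    measure (Pi\<^sub>M UNIV (\<lambda>j. if j \<in> J then distr (r j) (M j) (y j) else M j)) C = 0"
  using finite[of J] d
proof (induction J arbitrary: d rule: finite_induct)
  case empty
  have "\<exists>y. \<forall>j (l :: 'n option). y j l \<in> space (M j)"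
    using prob_space.not_empty[OF M] by (intro exI[of _ "\<lambda>j l. SOME x. x \<in> space (M j)"]) (simp add: some_in_eq)
  then show ?case using empty C by auto
next
  case (insert k J)
  obtain r :: "'m \<Rightarrow> 'n option pmf" and y where y: "\<forall>j l. y j l \<in> space (M j)"
    and r: "\<forall>i. \<bar>measure (Pi\<^sub>M UNIV (\<lambda>j. if j \<in> J then distr (r j) (M j) (y j) else M j)) (A i)
          - measure (Pi\<^sub>M UNIV M) (A i)\<bar> < d / 2"
    and rC: "measure (Pi\<^sub>M UNIV (\<lambda>j. if j \<in> J then distr (r j) (M j) (y j) else M j)) C = 0"
    using insert.IH[of "d / 2"] insert.prems by auto
  let ?M = "\<lambda>j. if j \<in> J then distr (r j) (M j) (y j) else M j"
  have M': "prob_space (?M j)" for j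
    using M[of j] y by (auto intro!: measure_pmf.prob_space_distr)
  have sets: "sets (Pi\<^sub>M UNIV ?M) = sets (Pi\<^sub>M UNIV M)" by (intro sets_PiM_cong) auto
  obtain r' :: "'n option pmf" and y' where y': "\<And>l. y' l \<in> space (?M k)"
    and r': "\<And>i. \<bar>measure (Pi\<^sub>M UNIV (?M(k := distr r' (?M k) y'))) (A i) - measure (Pi\<^sub>M UNIV ?M) (A i)\<bar> < d / 2"
    and rC': "measure (Pi\<^sub>M UNIV (?M(k := distr r' (?M k) y'))) C = 0"
  proof (rule discretise_coordinate[of ?M A C "d / 2" k, OF M' _ _ rC])
    show "A i \<in> sets (Pi\<^sub>M UNIV ?M)" "C \<in> sets (Pi\<^sub>M UNIV ?M)" for i
      using A C by (simp_all only: sets)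
    show "0 < d / 2" using insert.prems by simp
  qed (rule that; blast)
  have Mk: "?M k = M k" using insert.hyps by simp
  have eq: "?M(k := distr r' (?M k) y') =
      (\<lambda>j. if j \<in> insert k J then distr ((r(k := r')) j) (M j) ((y(k := y')) j) else M j)"
    using insert.hyps by (auto simp: fun_eq_iff)
  show ?case
  proof (intro exI[of _ "r(k := r')"] exI[of _ "y(k := y')"] conjI allI)
    show "(y(k := y')) j l \<in> space (M j)" for j l using y y' Mk by auto
    show "\<bar>measure (Pi\<^sub>M UNIV (\<lambda>j. if j \<in> insert k J then distr ((r(k := r')) j) (M j) ((y(k := y')) j) else M j)) (A i)
          - measure (Pi\<^sub>M UNIV M) (A i)\<bar> < d" for i
      using r'[of i] r[THEN spec, of i] unfolding eq by linarith
  qed (use rC' in \<open>simp only: eq\<close>)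
qed

definition discrete_prob :: "('m::finite \<Rightarrow> 'l \<Rightarrow> real) \<Rightarrow> ('m \<Rightarrow> 'l) set \<Rightarrow> real" where
  "discrete_prob \<alpha> D = (\<Sum>\<kappa>\<in>D. \<Prod>j\<in>UNIV. \<alpha> j (\<kappa> j))"

lemma measure_PiM_finite_range:
  fixes M :: "'m::finite \<Rightarrow> 'a measure" and \<phi> :: "'m \<Rightarrow> 'a \<Rightarrow> 'l::finite"
  assumes M: "\<And>j. prob_space (M j)" and \<phi>: "\<And>j. \<phi> j \<in> measurable (M j) (count_space UNIV)"
  shows "{x \<in> space (Pi\<^sub>M UNIV M). (\<lambda>j. \<phi> j (x j)) \<in> D} \<in> sets (Pi\<^sub>M UNIV M)"
    and "measure (Pi\<^sub>M UNIV M) {x \<in> space (Pi\<^sub>M UNIV M). (\<lambda>j. \<phi> j (x j)) \<in> D} =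
      discrete_prob (\<lambda>j l. measure (M j) {x \<in> space (M j). \<phi> j x = l}) D"
proof -
  interpret product_prob_space M by (rule product_prob_spaceI) (rule M)
  interpret PU: prob_space "Pi\<^sub>M UNIV M" by (intro prob_space_PiM M)
  let ?F = "\<lambda>j l. {x \<in> space (M j). \<phi> j x = l}" and ?X = "\<lambda>\<kappa>. {x \<in> space (Pi\<^sub>M UNIV M). (\<lambda>j. \<phi> j (x j)) = \<kappa>}"
  have F: "?F j l \<in> sets (M j)" for j l
    using measurable_sets[OF \<phi>[of j], of "{l}"] by (simp add: vimage_def Int_def conj_commute)
  have X: "?X \<kappa> = Pi\<^sub>E UNIV (\<lambda>j. ?F j (\<kappa> j))" for \<kappa> by (auto simp: space_PiM PiE_iff fun_eq_iff)
  have Xs: "?X \<kappa> \<in> sets (Pi\<^sub>M UNIV M)" for \<kappa> unfolding X using F by (intro sets_PiM_I_finite) auto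
  have mX: "measure (Pi\<^sub>M UNIV M) (?X \<kappa>) = (\<Prod>j\<in>UNIV. measure (M j) (?F j (\<kappa> j)))" for \<kappa>
  proof -
    have "emeasure (Pi\<^sub>M UNIV M) (?X \<kappa>) = (\<Prod>j\<in>UNIV. emeasure (M j) (?F j (\<kappa> j)))"
      unfolding X using F by (intro emeasure_PiM) auto
    then show ?thesis
      by (simp add: PU.emeasure_eq_measure M.emeasure_eq_measure prod_ennreal prod_nonneg)
  qed
  have un: "{x \<in> space (Pi\<^sub>M UNIV M). (\<lambda>j. \<phi> j (x j)) \<in> D} = (\<Union>\<kappa>\<in>D. ?X \<kappa>)" by auto
  show "{x \<in> space (Pi\<^sub>M UNIV M). (\<lambda>j. \<phi> j (x j)) \<in> D} \<in> sets (Pi\<^sub>M UNIV M)"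
    unfolding un using Xs by (intro sets.finite_UN) auto
  have "measure (Pi\<^sub>M UNIV M) (\<Union>\<kappa>\<in>D. ?X \<kappa>) = (\<Sum>\<kappa>\<in>D. measure (Pi\<^sub>M UNIV M) (?X \<kappa>))"
    using Xs by (intro PU.finite_measure_finite_Union) (auto simp: disjoint_family_on_def)
  then show "measure (Pi\<^sub>M UNIV M) {x \<in> space (Pi\<^sub>M UNIV M). (\<lambda>j. \<phi> j (x j)) \<in> D} =
      discrete_prob (\<lambda>j l. measure (M j) {x \<in> space (M j). \<phi> j x = l}) D"
    by (simp only: un discrete_prob_def mX)
qed

text \<open>A product of image measures is the image of the product, so the measure of
  \<open>X\<close> is a finite sum over the index tuples whose points land in
  \<open>X\<close>.\<close>

lemma measure_PiM_distr_pmf: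
  fixes M :: "'m::finite \<Rightarrow> 'a measure" and r :: "'m \<Rightarrow> 'l::finite pmf"
  assumes M: "\<And>j. prob_space (M j)" and y: "\<And>j l. y j l \<in> space (M j)"
    and X: "X \<in> sets (Pi\<^sub>M UNIV M)"
  shows "measure (Pi\<^sub>M UNIV (\<lambda>j. distr (r j) (M j) (y j))) X =
    discrete_prob (\<lambda>j. pmf (r j)) {\<kappa>. (\<lambda>j. y j (\<kappa> j)) \<in> X}"
proof -
  let ?R = "Pi\<^sub>M UNIV (\<lambda>j. measure_pmf (r j))" and ?D = "\<lambda>j. distr (measure_pmf (r j)) (M j) (y j)"
  let ?t = "\<lambda>\<kappa> j. y j (\<kappa> j)"
  have ym: "y j \<in> measurable (measure_pmf (r j)) (M j)" for j using y by simp
  interpret R: product_prob_space "\<lambda>j. measure_pmf (r j)"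
    by (rule product_prob_spaceI) (rule measure_pmf.prob_space_axioms)
  interpret D: product_prob_space ?D
    by (rule product_prob_spaceI) (rule measure_pmf.prob_space_distr[OF ym])
  have tm: "?t \<in> measurable ?R (Pi\<^sub>M UNIV M)"
  proof (rule measurable_PiM_single')
    show "(\<lambda>\<kappa>. y j (\<kappa> j)) \<in> measurable ?R (M j)" for j
      by (rule measurable_compose[of "\<lambda>\<kappa>. \<kappa> j" ?R "measure_pmf (r j)", OF _ ym]) simp
  qed (auto simp: space_PiM y)
  have sets: "sets (Pi\<^sub>M UNIV ?D) = sets (Pi\<^sub>M UNIV M)" by (intro sets_PiM_cong) auto
  have "distr ?R (Pi\<^sub>M UNIV M) ?t = Pi\<^sub>M UNIV ?D"
  proof (rule D.PiM_eqI)
    fix A assume A: "\<And>j. j \<in> UNIV \<Longrightarrow> A j \<in> sets (?D j)"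
    have "emeasure (distr ?R (Pi\<^sub>M UNIV M) ?t) (Pi\<^sub>E UNIV A) = emeasure ?R (?t -` Pi\<^sub>E UNIV A \<inter> space ?R)"
      using A by (intro emeasure_distr tm sets_PiM_I_finite) auto
    also have "?t -` Pi\<^sub>E UNIV A \<inter> space ?R = Pi\<^sub>E UNIV (\<lambda>j. y j -` A j)"
      by (auto simp: space_PiM)
    also have "emeasure ?R \<dots> = (\<Prod>j\<in>UNIV. emeasure (r j) (y j -` A j))"
      by (intro R.emeasure_PiM) auto
    also have "\<dots> = (\<Prod>j\<in>UNIV. emeasure (?D j) (A j))"
      using A by (intro prod.cong refl, subst emeasure_distr[OF ym]) auto
    finally show "emeasure (distr ?R (Pi\<^sub>M UNIV M) ?t) (Pi\<^sub>E UNIV A) = (\<Prod>j\<in>UNIV. emeasure (?D j) (A j))" .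
  qed (simp_all add: sets)
  then have "measure (Pi\<^sub>M UNIV ?D) X = measure (distr ?R (Pi\<^sub>M UNIV M) ?t) X" by simp
  also have "\<dots> = measure ?R {\<kappa> \<in> space ?R. (\<lambda>j. id (\<kappa> j)) \<in> {\<kappa>. ?t \<kappa> \<in> X}}"
    by (subst measure_distr[OF tm X]) (auto intro!: arg_cong[where f = "measure ?R"])
  also have "\<dots> = discrete_prob (\<lambda>j l. measure (r j) {x \<in> space (r j). id x = l}) {\<kappa>. ?t \<kappa> \<in> X}"
    by (rule measure_PiM_finite_range) (auto intro: measure_pmf.prob_space_axioms)
  finally show ?thesis by (simp add: measure_pmf_single)
qed

subsection \<open>Covering families\<close>

definition weight_simplices :: "(real ^ 'l::finite ^ 'm::finite) set" where
  "weight_simplices = {\<alpha>. (\<forall>j l. 0 \<le> \<alpha> $ j $ l) \<and> (\<forall>j. (\<Sum>l\<in>UNIV. \<alpha> $ j $ l) = 1)}"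

text \<open>The index tuples outside all \<open>D i\<close> may exist as long as their total weight
  is 0. This is a closed condition on the weights, since \<open>discrete_prob\<close> is polynomial
  in them.\<close>

definition pattern_covering_vectors ::
    "('n::finite \<Rightarrow> ('m::finite \<Rightarrow> 'l::finite) set) \<Rightarrow> (real ^ 'n) set" where
  "pattern_covering_vectors D =
    (\<lambda>\<alpha>. \<chi> i. discrete_prob (\<lambda>j l. \<alpha> $ j $ l) (D i)) `
      {\<alpha> \<in> weight_simplices. discrete_prob (\<lambda>j l. \<alpha> $ j $ l) (- (\<Union>i. D i)) = 0}"

definition pattern_conforms :: "('n \<times> 'm) set \<Rightarrow> ('n \<Rightarrow> ('m \<Rightarrow> 'l) set) \<Rightarrow> bool" where
  "pattern_conforms E D \<longleftrightarrow>
    (\<forall>i \<kappa> \<kappa>'. (\<forall>j\<in>nbhd E i. \<kappa> j = \<kappa>' j) \<longrightarrow> (\<kappa> \<in> D i \<longleftrightarrow> \<kappa>' \<in> D i))"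

lemma compact_weight_simplices: "compact (weight_simplices :: (real ^ 'l::finite ^ 'm::finite) set)"
proof -
  let ?K = "weight_simplices :: (real ^ 'l ^ 'm) set"
  have "?K = (\<Inter>j. \<Inter>l. {\<alpha>. 0 \<le> \<alpha> $ j $ l}) \<inter> (\<Inter>j. {\<alpha>. (\<Sum>l\<in>UNIV. \<alpha> $ j $ l) = 1})"
    by (auto simp: weight_simplices_def)
  moreover have "closed \<dots>"
    by (intro closed_Int closed_INT ballI closed_Collect_le closed_Collect_eq continuous_intros)
  ultimately have "closed ?K" by simp
  moreover have "bounded ?K"
  proof (rule boundedI)
    fix \<alpha> assume \<alpha>: "\<alpha> \<in> ?K"
    have "norm \<alpha> \<le> (\<Sum>j\<in>UNIV. norm (\<alpha> $ j))" by (simp add: norm_vec_def L2_set_le_sum)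
    also have "\<dots> \<le> (\<Sum>j\<in>(UNIV :: 'm set). 1)"
    proof (rule sum_mono)
      fix j
      have "norm (\<alpha> $ j) \<le> (\<Sum>l\<in>UNIV. \<bar>\<alpha> $ j $ l\<bar>)" by (rule norm_le_l1_cart)
      also have "\<dots> = (\<Sum>l\<in>UNIV. \<alpha> $ j $ l)" using \<alpha> by (intro sum.cong) (auto simp: weight_simplices_def)
      finally show "norm (\<alpha> $ j) \<le> 1" using \<alpha> by (simp add: weight_simplices_def)
    qed
    finally show "norm \<alpha> \<le> (\<Sum>j\<in>(UNIV :: 'm set). 1)" .
  qed
  ultimately show ?thesis by (simp add: compact_eq_bounded_closed)
qed

lemma continuous_on_discrete_prob:
  "continuous_on X (\<lambda>\<alpha> :: real ^ 'l::finite ^ 'm::finite. discrete_prob (\<lambda>j l. \<alpha> $ j $ l) D)"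
  unfolding discrete_prob_def by (intro continuous_intros)

lemma compact_pattern_covering_vectors:
  "compact (pattern_covering_vectors (D :: 'n::finite \<Rightarrow> ('m::finite \<Rightarrow> 'l::finite) set))"
  unfolding pattern_covering_vectors_def
proof (rule compact_continuous_image)
  show "continuous_on {\<alpha> \<in> weight_simplices. discrete_prob (\<lambda>j l. \<alpha> $ j $ l) (- (\<Union>i. D i)) = 0}
     (\<lambda>\<alpha>. \<chi> i. discrete_prob (\<lambda>j l. \<alpha> $ j $ l) (D i))"
    by (intro continuous_on_vec_lambda continuous_on_discrete_prob)
  have "closed {\<alpha> :: real ^ 'l ^ 'm. discrete_prob (\<lambda>j l. \<alpha> $ j $ l) (- (\<Union>i. D i)) = 0}"
    by (intro closed_Collect_eq continuous_on_discrete_prob continuous_on_const)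
  from compact_Int_closed[OF compact_weight_simplices this]
  show "compact {\<alpha> \<in> weight_simplices. discrete_prob (\<lambda>j l. \<alpha> $ j $ l) (- (\<Union>i. D i)) = 0}"
    by (simp add: Collect_conj_eq)
qed

text \<open>The value type \<open>'n option\<close> is fixed in advance, so there are finitely many
  patterns and the union of compact sets is closed.\<close>

definition covering_vectors :: "('n::finite \<times> 'm::finite) set \<Rightarrow> (real ^ 'n) set" where
  "covering_vectors E =
    (\<Union>D \<in> {D :: 'n \<Rightarrow> ('m \<Rightarrow> 'n option) set. pattern_conforms E D}. pattern_covering_vectors D)"

lemma closed_covering_vectors: "closed (covering_vectors E)"
  unfolding covering_vectors_def
  by (intro closed_UN ballI compact_imp_closed compact_pattern_covering_vectors) simp

text \<open>Discretisation gives covering vectors arbitrarily close to the given one, and closedness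
  makes it one itself. The pattern of \<open>A i\<close> collects the index tuples whose points lie
  in \<open>A i\<close>.\<close>

lemma covering_family_imp_covering_vector:
  fixes E :: "('n::finite \<times> 'm::finite) set"
  assumes A: "borel_family E A" and C: "measure unit_cube (avoiding unit_cube A UNIV) = 0"
  shows "(\<chi> i. measure unit_cube (A i)) \<in> covering_vectors E" (is "?q \<in> _")
proof -
  note As = borel_familyD(2)[OF A]
  let ?C = "avoiding unit_cube A UNIV"
  have Cs: "?C \<in> sets unit_cube" using As by (auto simp: avoiding_eq)
  have "\<exists>v\<in>covering_vectors E. dist v ?q < e" if e: "0 < e" for e
  proof -
    \<comment> \<open>The Euclidean distance is bounded by the sum of \<open>CARD('n)\<close>
      coordinate errors.\<close>
    let ?d = "e / CARD('n)"
    have d: "0 < ?d" using e by simp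
    have "\<exists>(r :: 'm \<Rightarrow> 'n option pmf) y. (\<forall>j l. y j l \<in> space unit_interval) \<and>
      (\<forall>i. \<bar>measure (Pi\<^sub>M UNIV (\<lambda>j. distr (r j) unit_interval (y j))) (A i) - measure unit_cube (A i)\<bar> < ?d) \<and>
      measure (Pi\<^sub>M UNIV (\<lambda>j. distr (r j) unit_interval (y j))) ?C = 0"
      using discretise_coordinates[of "\<lambda>_. unit_interval" A ?C ?d UNIV, OF prob_space_unit_interval As Cs C d]
      by (simp only: UNIV_I if_True)
    then obtain r :: "'m \<Rightarrow> 'n option pmf" and y where y: "\<And>j l. y j l \<in> space unit_interval"
      and r: "\<And>i. \<bar>measure (Pi\<^sub>M UNIV (\<lambda>j. distr (r j) unit_interval (y j))) (A i) - measure unit_cube (A i)\<bar> < ?d"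
      and rC: "measure (Pi\<^sub>M UNIV (\<lambda>j. distr (r j) unit_interval (y j))) ?C = 0"
      by blast
    define D where "D i = {\<kappa>. (\<lambda>j. y j (\<kappa> j)) \<in> A i}" for i
    have sp: "(\<lambda>j. y j (\<kappa> j)) \<in> space unit_cube" for \<kappa> using y by (simp add: space_unit_cube)
    note eq = measure_PiM_distr_pmf[of "\<lambda>_. unit_interval" y _ r, OF prob_space_unit_interval y]
    have "{\<kappa>. (\<lambda>j. y j (\<kappa> j)) \<in> ?C} = - (\<Union>i. D i)" using sp by (auto simp: avoiding_def D_def)
    then have DC: "discrete_prob (\<lambda>j. pmf (r j)) (- (\<Union>i. D i)) = 0" using rC eq[OF Cs] by simp
    have rD: "\<bar>discrete_prob (\<lambda>j. pmf (r j)) (D i) - measure unit_cube (A i)\<bar> < ?d" for i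
      using r[of i] eq[OF As] by (simp add: D_def)
    have "pattern_conforms E D"
      unfolding pattern_conforms_def D_def
    proof (intro allI impI)
      fix i \<kappa> \<kappa>' assume "\<forall>j\<in>nbhd E i. \<kappa> j = (\<kappa>' j :: 'n option)"
      then show "\<kappa> \<in> {\<kappa>. (\<lambda>j. y j (\<kappa> j)) \<in> A i} \<longleftrightarrow> \<kappa>' \<in> {\<kappa>. (\<lambda>j. y j (\<kappa> j)) \<in> A i}"
        unfolding mem_Collect_eq by (intro borel_cylinderD[OF borel_familyD(1)[OF A] sp sp]) simp
    qed
    moreover have "(\<chi> i. discrete_prob (\<lambda>j. pmf (r j)) (D i)) \<in> pattern_covering_vectors D" (is "?v \<in> _")
    proof -
      define \<alpha> where "\<alpha> = (\<chi> j l. pmf (r j) l)"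
      have "\<alpha> \<in> weight_simplices" by (simp add: weight_simplices_def \<alpha>_def sum_pmf_eq_1)
      moreover have "(\<lambda>j l. \<alpha> $ j $ l) = (\<lambda>j. pmf (r j))" by (intro ext) (simp add: \<alpha>_def)
      ultimately show ?thesis
        unfolding pattern_covering_vectors_def using DC by (intro image_eqI[of _ _ \<alpha>]) simp_all
    qed
    ultimately have "?v \<in> covering_vectors E" by (auto simp: covering_vectors_def)
    moreover have "dist ?v ?q < e"
    proof -
      have "dist ?v ?q \<le> (\<Sum>i\<in>UNIV. \<bar>(?v - ?q) $ i\<bar>)" unfolding dist_norm by (rule norm_le_l1_cart)
      also have "\<dots> < (\<Sum>i\<in>(UNIV :: 'n set). ?d)" using rD by (intro sum_strict_mono) auto
      finally show ?thesis by simp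
    qed
    ultimately show ?thesis by blast
  qed
  then have "?q \<in> closure (covering_vectors E)" by (auto simp: closure_approachable)
  then show ?thesis by (simp add: closed_covering_vectors)
qed

lemma interval_partition:
  fixes w :: "'l \<Rightarrow> real"
  assumes "finite L" "\<And>l. l \<in> L \<Longrightarrow> 0 \<le> w l"
  shows "\<exists>S. (\<forall>l\<in>L. S l \<in> sets borel \<and> emeasure lborel (S l) = w l) \<and> disjoint_family_on S L \<and>
    (\<Union>l\<in>L. S l) = {a..<a + sum w L}"
  using assms
proof (induction L arbitrary: a rule: finite_induct)
  case empty
  then show ?case by (auto simp: disjoint_family_on_def)
next
  case (insert k L)
  let ?b = "a + w k"
  obtain S where S: "\<forall>l\<in>L. S l \<in> sets borel \<and> emeasure lborel (S l) = w l" "disjoint_family_on S L"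
    "(\<Union>l\<in>L. S l) = {?b..<?b + sum w L}"
    using insert.IH[of ?b] insert.prems by auto
  let ?S = "S(k := {a..<?b})"
  have w: "0 \<le> w k" "0 \<le> sum w L" using insert.prems by (auto intro: sum_nonneg)
  have SL: "(\<Union>l\<in>L. ?S l) = {?b..<?b + sum w L}" using S(3) insert.hyps by (auto split: if_splits)
  show ?case
  proof (intro exI[of _ ?S] conjI ballI)
    show "?S l \<in> sets borel" "emeasure lborel (?S l) = w l" if "l \<in> insert k L" for l
      using that S(1) w by auto
    have dis: "disjoint_family_on ?S L"
      using S(2) insert.hyps unfolding disjoint_family_on_def by auto
    have "{a..<?b} \<inter> (\<Union>l\<in>L. ?S l) = {}" unfolding SL by auto
    then show "disjoint_family_on ?S (insert k L)"
      using insert.hyps dis by (subst disjoint_family_on_insert) auto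
    show "(\<Union>l\<in>insert k L. ?S l) = {a..<a + sum w (insert k L)}"
      using SL w insert.hyps by (auto simp: algebra_simps)
  qed
qed

lemma ex_unit_interval_random_variable:
  fixes w :: "'l::finite \<Rightarrow> real"
  assumes w: "\<And>l. 0 \<le> w l" "sum w UNIV = 1"
  obtains \<phi> where "\<phi> \<in> measurable unit_interval (count_space UNIV)"
    "\<And>l. measure unit_interval {x \<in> space unit_interval. \<phi> x = l} = w l"
proof -
  obtain S where *: "\<forall>l\<in>UNIV. S l \<in> sets borel \<and> emeasure lborel (S l) = w l"
    "disjoint_family_on S UNIV" "(\<Union>l\<in>UNIV. S l) = {0..<0 + sum w UNIV}"
    using interval_partition[of "UNIV :: 'l set" w 0, OF finite w(1)] by blast
  then have S: "\<And>l. S l \<in> sets borel" "\<And>l. emeasure lborel (S l) = w l"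
    "disjoint_family_on S UNIV" "(\<Union>l. S l) = {0..<1}"
    by (simp_all add: w(2))
  obtain l0 :: 'l where True by simp
  \<comment> \<open>The half-open pieces miss the right end point 1; it is sent to
    \<open>l0\<close>, which changes the measures by 0.\<close>
  define \<phi> where "\<phi> x = (if x \<in> {0..<1} then THE l. x \<in> S l else l0)" for x
  have \<phi>S: "\<phi> x = l" if "x \<in> S l" for x l
  proof -
    have "(THE l. x \<in> S l) = l"
      using that S(3) by (intro the_equality) (auto simp: disjoint_family_on_def)
    moreover have "x \<in> {0..<1}" using that S(4) by auto
    ultimately show ?thesis by (simp add: \<phi>_def)
  qed
  define T where "T l = (if l = l0 then insert 1 (S l) else S l)" for l
  have T: "{x \<in> space unit_interval. \<phi> x = l} = T l" for l
  proof (rule set_eqI)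
    fix x
    show "x \<in> {x \<in> space unit_interval. \<phi> x = l} \<longleftrightarrow> x \<in> T l"
    proof (cases "x \<in> {0..<1}")
      case True
      then obtain l' where l': "x \<in> S l'" using S(4) by blast
      show ?thesis using True \<phi>S[OF l'] \<phi>S[of x l] l' by (auto simp: T_def)
    next
      case False
      then have "x \<notin> S l" using S(4) by auto
      then show ?thesis using False by (auto simp: T_def \<phi>_def)
    qed
  qed
  have Tb: "T l \<in> sets borel" "T l \<subseteq> {0..1}" for l
  proof -
    show "T l \<in> sets borel" using S(1) by (simp add: T_def)
    show "T l \<subseteq> {0..1}" using T[of l] by auto
  qed
  then have Ts: "T l \<in> sets unit_interval" for l by (simp add: sets_unit_interval_iff)
  have "emeasure lborel (T l) = w l" for l
  proof -
    have "emeasure lborel (insert 1 (S l)) = emeasure lborel (S l \<union> {1})" by simp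
    also have "\<dots> = emeasure lborel (S l)" using S(1) by (intro emeasure_Un_null_set) auto
    finally show ?thesis using S(2) by (cases "l = l0") (simp_all add: T_def)
  qed
  then have "measure unit_interval (T l) = w l" for l
    using Tb w(1) by (simp add: measure_def emeasure_unit_interval)
  moreover have "\<phi> \<in> measurable unit_interval (count_space UNIV)"
  proof (rule measurableI)
    fix X :: "'l set"
    have "\<phi> -` X \<inter> space unit_interval = (\<Union>l\<in>X. T l)" unfolding T[symmetric] by auto
    then show "\<phi> -` X \<inter> space unit_interval \<in> sets unit_interval"
      using Ts by (simp only:) (intro sets.finite_UN, auto)
  qed simp
  ultimately show ?thesis by (intro that[of \<phi>]) (simp_all only: T)
qed

text \<open>Each discrete variable is simulated by a function \<open>\<phi> j\<close> of the uniform
  one, and the pattern is pulled back. Acting coordinatewise, this respects the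
  neighbourhoods.\<close>

lemma covering_vector_imp_covering_family:
  fixes E :: "('n::finite \<times> 'm::finite) set"
  assumes q: "q \<in> covering_vectors E"
  shows "\<exists>A. borel_family E A \<and> (\<forall>i. measure unit_cube (A i) = q $ i) \<and>
    measure unit_cube (avoiding unit_cube A UNIV) = 0"
proof -
  obtain D :: "'n \<Rightarrow> ('m \<Rightarrow> 'n option) set" and \<alpha> where D: "pattern_conforms E D"
    and \<alpha>: "\<alpha> \<in> weight_simplices" and DC: "discrete_prob (\<lambda>j l. \<alpha> $ j $ l) (- (\<Union>i. D i)) = 0"
    and qD: "q = (\<chi> i. discrete_prob (\<lambda>j l. \<alpha> $ j $ l) (D i))"
    using q by (auto simp: covering_vectors_def pattern_covering_vectors_def)
  have "\<exists>\<phi>. \<phi> \<in> measurable unit_interval (count_space UNIV) \<and>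
      (\<forall>l. measure unit_interval {x \<in> space unit_interval. \<phi> x = l} = \<alpha> $ j $ l)" for j
    by (rule ex_unit_interval_random_variable[of "\<lambda>l. \<alpha> $ j $ l"])
      (use \<alpha> in \<open>simp_all add: weight_simplices_def, blast\<close>)
  then obtain \<phi> where \<phi>: "\<And>j. \<phi> j \<in> measurable unit_interval (count_space UNIV)"
    "\<And>j l. measure unit_interval {x \<in> space unit_interval. \<phi> j x = l} = \<alpha> $ j $ l"
    by metis
  let ?X = "\<lambda>D. {x \<in> space unit_cube. (\<lambda>j. \<phi> j (x j)) \<in> D}"
  note meas = measure_PiM_finite_range[of "\<lambda>_. unit_interval" \<phi>, OF prob_space_unit_interval \<phi>(1)]
  have m: "measure unit_cube (?X D) = discrete_prob (\<lambda>j l. \<alpha> $ j $ l) D" for D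
    using meas(2)[of D] unfolding \<phi>(2) .
  have "borel_family E (\<lambda>i. ?X (D i))"
    unfolding borel_family_def borel_cylinder_def
  proof (intro allI conjI ballI impI)
    show "?X (D i) \<in> sets unit_cube" for i by (rule meas(1))
    fix i x y
    assume xy: "x \<in> space unit_cube" "y \<in> space unit_cube" "\<forall>j\<in>nbhd E i. x j = y j"
    then have "(\<lambda>j. \<phi> j (x j)) \<in> D i \<longleftrightarrow> (\<lambda>j. \<phi> j (y j)) \<in> D i"
      using D[unfolded pattern_conforms_def, rule_format, of i "\<lambda>j. \<phi> j (x j)" "\<lambda>j. \<phi> j (y j)"] by simp
    then show "x \<in> ?X (D i) \<longleftrightarrow> y \<in> ?X (D i)" using xy by simp
  qed
  moreover have "measure unit_cube (?X (D i)) = q $ i" for i by (simp add: m qD)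
  moreover have "avoiding unit_cube (\<lambda>i. ?X (D i)) UNIV = ?X (- (\<Union>i. D i))"
    by (auto simp: avoiding_def)
  then have "measure unit_cube (avoiding unit_cube (\<lambda>i. ?X (D i)) UNIV) = 0" by (simp only: m DC)
  ultimately show ?thesis by blast
qed

subsection \<open>The boundary\<close>

lemma indep_poly_zero:
  fixes S :: "'a::finite set"
  shows "indep_poly G (\<lambda>_. 0) S = 1"
proof -
  have "indep_weight G (\<lambda>_. 0) U = (if U = {} then 1 else 0)" for U :: "'a set"
    by (auto simp: indep_weight_def independent_in_def)
  then have "indep_poly G (\<lambda>_. 0) S = (\<Sum>U\<in>Pow S. if U = {} then 1 else 0)"
    unfolding indep_poly_def by (intro sum.cong) auto
  then show ?thesis by simp
qed

text \<open>If some entry is 1, the whole cube serves as that event; this case is separate because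
  beyond it a vector leaves the interior by exceeding 1, with no covering family behind it.
  Otherwise slightly enlarged vectors still have entries below 1, so they are covering vectors and
  \<open>q\<close> is their limit.\<close>

lemma boundary_covering_family:
  fixes E :: "('n::finite \<times> 'm::finite) set"
  assumes nb: "\<forall>i. nbhd E i \<noteq> {}" and q: "q \<in> bigraph_boundary E"
  shows "\<exists>A. borel_family E A \<and> (\<forall>i. measure unit_cube (A i) = q $ i) \<and>
    measure unit_cube (avoiding unit_cube A UNIV) = 0"
proof (cases "\<exists>i. q $ i = 1")
  case True
  then obtain i0 where i0: "q $ i0 = 1" by blast
  have q01: "0 \<le> q $ i" "q $ i \<le> 1" for i using q by (auto simp: bigraph_boundary_def intro: less_imp_le)
  have "\<exists>Y. borel_cylinder (nbhd E i) Y \<and> (i = i0 \<longrightarrow> Y = space unit_cube) \<and> measure unit_cube Y = q $ i" for i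
  proof (cases "i = i0")
    case True
    then show ?thesis
      using i0 borel_cylinder_space[of "nbhd E i"] by (intro exI[of _ "space unit_cube"]) (simp add: unit.P.prob_space)
  next
    case False
    obtain j where j: "j \<in> nbhd E i" using nb by auto
    have "q $ i \<le> measure unit_cube (space (unit_cube :: ('m \<Rightarrow> real) measure))"
      using q01(2)[of i] by (simp add: unit.P.prob_space)
    then show ?thesis
      using borel_cylinder_subset_measure[OF borel_cylinder_space j q01(1)[of i]] False by metis
  qed
  then obtain A where A: "\<And>i. borel_cylinder (nbhd E i) (A i)" "A i0 = space unit_cube"
    "\<And>i. measure unit_cube (A i) = q $ i"
    by metis
  have "avoiding unit_cube A UNIV = {}" using A(2) by (auto simp: avoiding_def)
  then show ?thesis using A by (intro exI[of _ A]) (simp add: borel_family_def)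
next
  case False
  then have q01: "0 < q $ i" "q $ i < 1" for i
    using q by (auto simp: bigraph_boundary_def less_le)
  have lim: "((\<lambda>\<epsilon>. (1 + \<epsilon>) *\<^sub>R q) \<longlongrightarrow> (1 + 0) *\<^sub>R q) (at_right 0)"
    by (intro tendsto_intros)
  have "\<forall>\<^sub>F \<epsilon> in at_right 0. \<forall>i. (1 + \<epsilon>) * q $ i < 1"
  proof (rule eventually_all_finite)
    fix i
    have "((\<lambda>\<epsilon>. (1 + \<epsilon>) * q $ i) \<longlongrightarrow> (1 + 0) * q $ i) (at_right 0)" by (intro tendsto_intros)
    then show "\<forall>\<^sub>F \<epsilon> in at_right 0. (1 + \<epsilon>) * q $ i < 1" using q01[of i] by (intro order_tendstoD(2)) auto
  qed
  moreover have "\<forall>\<^sub>F \<epsilon> in at_right (0::real). \<epsilon> \<in> {0<..<1}" by (rule eventually_at_right_real) simp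
  ultimately have "\<forall>\<^sub>F \<epsilon> in at_right 0. (1 + \<epsilon>) *\<^sub>R q \<in> covering_vectors E"
  proof eventually_elim
    case (elim \<epsilon>)
    then have \<epsilon>: "0 < \<epsilon>" "\<epsilon> < 1" "\<And>i. (1 + \<epsilon>) * q $ i < 1" by auto
    have "(1 + \<epsilon>) *\<^sub>R q \<notin> bigraph_interior E" using q \<epsilon> by (auto simp: bigraph_boundary_def)
    then obtain A where A: "borel_family E A" "\<And>i. measure unit_cube (A i) = ((1 + \<epsilon>) *\<^sub>R q) $ i"
      "\<not> measure unit_cube (avoiding unit_cube A UNIV) > 0"
      unfolding bigraph_interior_iff_borel using \<epsilon> q01 by auto
    then have "measure unit_cube (avoiding unit_cube A UNIV) = 0"
      by (simp add: not_less measure_le_0_iff)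
    from covering_family_imp_covering_vector[OF A(1) this]
    show ?case by (simp only: A(2) vec_nth_inverse)
  qed
  from Lim_in_closed_set[OF closed_covering_vectors this _ lim]
  have "q \<in> covering_vectors E" by simp
  then show ?thesis by (rule covering_vector_imp_covering_family)
qed

text \<open>Each polynomial starts at 1 on the ray. At the earliest zero \<open>t0\<close> of any of
  them all are still nonnegative, so connectedness puts the zero at \<open>UNIV\<close> and
  Shearer's space excludes \<open>t0 *\<^sub>R p\<close> from the abstract interior. Without a gap
  it also leaves the interior, although \<open>t0 < l\<close>.\<close>

lemma indep_poly_nonneg_at_boundary:
  fixes E :: "('n::finite \<times> 'm::finite) set"
  assumes conn: "graph_connected (base_graph E)" and p: "\<forall>i. 0 < p $ i" and l: "0 < l"
    and b: "l *\<^sub>R p \<in> bigraph_boundary E" and gap: "gapless_in_direction E p"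
  shows "0 \<le> indep_poly (base_graph E) (\<lambda>i. l * p $ i) S"
proof (rule ccontr)
  let ?G = "base_graph E"
  let ?I = "\<lambda>S t. indep_poly ?G (\<lambda>i. t * p $ i) S"
  assume neg: "\<not> 0 \<le> ?I S l"
  have I0: "?I S 0 = 1" for S by (simp add: indep_poly_zero)
  have ivt: "\<exists>s\<ge>0. s \<le> t \<and> ?I S s = 0" if "?I S t \<le> 0" "0 \<le> t" for S t
    using IVT2'[of "?I S" t 0 0] that I0[of S] continuous_on_indep_poly[of "{0..t}" ?G "($) p" S] by auto
  let ?Z = "{t \<in> {0..l}. \<exists>S. ?I S t = 0}"
  have "?Z = {0..l} \<inter> (\<Union>S. {t. ?I S t = 0})" by auto
  moreover have "closed (\<Union>S. {t. ?I S t = 0})"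
    by (intro closed_UN ballI closed_Collect_eq continuous_on_indep_poly continuous_on_const) simp
  ultimately have "compact ?Z" by (simp only: compact_Int_closed compact_Icc)
  moreover obtain t where t: "0 \<le> t" "t \<le> l" "?I S t = 0" using ivt[where S = S and t = l] neg l by auto
  then have "?Z \<noteq> {}" by auto
  ultimately obtain t0 where t0: "t0 \<in> ?Z" "\<And>s. s \<in> ?Z \<Longrightarrow> t0 \<le> s"
    using compact_attains_inf[of ?Z] by blast
  \<comment> \<open>The value at \<open>l\<close> is strictly negative, so the zero found before it
    is strictly earlier and \<open>t0 < l\<close>.\<close>
  have "t \<noteq> l" using t(3) neg by auto
  moreover have "t0 \<le> t" using t by (intro t0(2)) auto
  ultimately have tl: "t0 < l" using t(2) by simp
  have t0pos: "0 < t0" using t0(1) I0 by (cases "t0 = 0") auto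
  have nn: "0 \<le> ?I S t0" for S
  proof (rule ccontr)
    assume neg0: "\<not> 0 \<le> ?I S t0"
    then obtain s where s: "0 \<le> s" "s \<le> t0" "?I S s = 0"
      using ivt[where S = S and t = t0] t0pos by auto
    moreover have "s \<noteq> t0" using s(3) neg0 by auto
    ultimately have "s \<in> ?Z" using tl by auto
    then show False using t0(2)[of s] s \<open>s \<noteq> t0\<close> by simp
  qed
  have "?I UNIV t0 = 0"
  proof (rule ccontr)
    assume "?I UNIV t0 \<noteq> 0"
    moreover have "0 < ?I S t0" if "S \<noteq> UNIV" for S
      using p t0pos that by (intro indep_poly_pos_or_UNIV_zero sym_base_graph irrefl_base_graph conn nn) auto
    ultimately have "?I S t0 \<noteq> 0" for S by (cases "S = UNIV") (auto simp: less_le)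
    then show False using t0(1) by auto
  qed
  moreover have nth: "($) (t0 *\<^sub>R p) = (\<lambda>i. t0 * p $ i)" by (simp add: fun_eq_iff)
  ultimately have "t0 *\<^sub>R p \<notin> abstract_interior ?G"
    using nn p t0pos
    by (intro not_abstract_interior_if_indep_poly_zero sym_base_graph irrefl_base_graph) (simp_all add: nth)
  then have "t0 *\<^sub>R p \<notin> bigraph_interior E" using gap t0pos by (simp add: gapless_in_direction_def)
  \<comment> \<open>The definition of the boundary is used with \<open>\<epsilon>\<close> equal to
    \<open>1 - t0 / l\<close>.\<close>
  moreover have "(1 - (1 - t0 / l)) *\<^sub>R (l *\<^sub>R p) \<in> bigraph_interior E"
  proof -
    have "0 < 1 - t0 / l" "1 - t0 / l < 1" using t0pos tl l by simp_all
    then show ?thesis using b unfolding bigraph_boundary_def by blast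
  qed
  moreover have "(1 - (1 - t0 / l)) *\<^sub>R (l *\<^sub>R p) = t0 *\<^sub>R p" using l by simp
  ultimately show False by (simp only:)
qed

text \<open>Rigidity identifies all avoidance probabilities of a covering family with the
  polynomial. For an edge \<open>(u, v)\<close> the value at \<open>{u, v}\<close> is
  \<open>1 - ?q u - ?q v\<close>, and comparison with inclusion-exclusion leaves measure 0 for the
  intersection.\<close>

lemma boundary_exclusive_if_gapless:
  fixes E :: "('n::finite \<times> 'm::finite) set"
  assumes nb: "\<forall>i. nbhd E i \<noteq> {}" and conn: "graph_connected (base_graph E)"
    and p: "\<forall>i. 0 < p $ i" and l: "0 < l"
    and b: "l *\<^sub>R p \<in> bigraph_boundary E" and gap: "gapless_in_direction E p"
  shows "has_exclusive_family E (l *\<^sub>R p)"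
proof -
  let ?G = "base_graph E"
  let ?q = "\<lambda>i. l * p $ i"
  obtain A where A: "borel_family E A" and Aq: "\<And>i. measure unit_cube (A i) = ?q i"
    and cover: "measure unit_cube (avoiding unit_cube A UNIV) = 0"
    using boundary_covering_family[OF nb b] by auto
  note As = borel_familyD(2)[OF A]
  let ?P = "\<lambda>S. measure unit_cube (avoiding unit_cube A S)" and ?I = "indep_poly ?G ?q"
  note nn = indep_poly_nonneg_at_boundary[OF conn p l b gap]
  note rec = indep_poly_rec[OF sym_base_graph[of E] irrefl_base_graph[of E]]
  have qpos: "0 < ?q i" for i using p l by simp
  have PI: "?P S = ?I S" for S
  proof (rule shearer_boundary_rigidity[where P = ?P and I = ?I and q = ?q and G = ?G])
    show "?P S \<ge> ?P (S - {v}) - ?q v * ?P (S - {v} - ?G `` {v})" if "v \<in> S" for S v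
      by (rule avoiding_rec_ge[OF prob_space_unit_cube As Aq borel_family_dependency_graph[OF A] that])
    show "0 < ?I S" if "S \<noteq> UNIV" for S
      by (rule indep_poly_pos_or_UNIV_zero[OF sym_base_graph irrefl_base_graph conn qpos nn that])
    show "?P {} = 1" by (simp add: avoiding_def unit.P.prob_space)
    show "0 < ?q v" for v by (rule qpos)
  qed (rule sym_base_graph irrefl_base_graph conn nn cover rec indep_poly_empty | assumption)+
  have excl: "measure unit_cube (A u \<inter> A v) = 0" if uv: "(u, v) \<in> ?G" for u v
  proof -
    have "u \<noteq> v" using uv by (auto simp: base_graph_def)
    have "?I {v} = 1 - ?q v" using rec[where v = v and S = "{v}" and q = ?q] by simp
    moreover have "?I {u, v} = ?I {v} - ?q u"
    proof -
      have *: "{u, v} - {u} = {v}" "{v} - ?G `` {u} = {}" using uv \<open>u \<noteq> v\<close> by auto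
      show ?thesis using rec[of u "{u, v}", where q = ?q] by (simp only: * indep_poly_empty) simp
    qed
    moreover have "?P {u, v} = 1 - measure unit_cube (A u \<union> A v)"
      using As by (simp add: avoiding_eq unit.P.prob_compl)
    moreover have "measure unit_cube (A u \<union> A v) = ?q u + ?q v - measure unit_cube (A u \<inter> A v)"
      using As by (subst unit.P.finite_measure_Union') (auto simp: Aq unit.P.finite_measure_Diff' Int_commute)
    ultimately show ?thesis using PI[of "{u, v}"] by simp
  qed
  show ?thesis
    unfolding has_exclusive_family_iff_borel using A Aq excl by (intro exI[of _ A]) auto
qed

theorem theorem5:
  fixes E :: "('n::finite \<times> 'm::finite) set" and p :: "real ^ 'n"
  assumes "\<forall>i. nbhd E i \<noteq> {}"
    and "graph_connected (base_graph E)"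
    and "\<forall>i. 0 < p $ i"
  shows "((\<forall>l>0. l *\<^sub>R p \<in> bigraph_interior E \<longrightarrow> has_exclusive_family E (l *\<^sub>R p)) \<longleftrightarrow>
          (\<forall>l>0. l *\<^sub>R p \<in> bigraph_boundary E \<longrightarrow> has_exclusive_family E (l *\<^sub>R p))) \<and>
         ((\<forall>l>0. l *\<^sub>R p \<in> bigraph_boundary E \<longrightarrow> has_exclusive_family E (l *\<^sub>R p)) \<longleftrightarrow>
          gapless_in_direction E p)"
    (is "(?interior \<longleftrightarrow> ?boundary) \<and> (_ \<longleftrightarrow> ?gapless)")
proof -
  \<comment> \<open>The equivalences are closed as a cycle from \<open>?interior\<close> to
    \<open>?gapless\<close> to \<open>?boundary\<close> and back. Here one inclusion of the
    interiors holds for every bigraph, and exclusive families give the other.\<close>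
  have "?gapless" if ?interior
    unfolding gapless_in_direction_def
    using that abstract_interior_if_exclusive abstract_interior_subset_bigraph_interior by blast
  moreover have ?boundary if ?gapless
    using boundary_exclusive_if_gapless[OF assms _ _ that] by blast
  moreover have ?interior if boundary: ?boundary
  proof (intro allI impI)
    fix k :: real assume k: "0 < k" "k *\<^sub>R p \<in> bigraph_interior E"
    obtain l where l: "0 < l" "l *\<^sub>R p \<in> bigraph_boundary E"
      "\<And>k. 0 < k \<Longrightarrow> k *\<^sub>R p \<in> bigraph_interior E \<Longrightarrow> k \<le> l"
      using ex_boundary[OF assms(1,3)] by blast
    have "has_exclusive_family E (l *\<^sub>R p)" using boundary l(1,2) by blast
    then show "has_exclusive_family E (k *\<^sub>R p)"
      by (rule has_exclusive_family_scale_down[OF assms(1,3) _ k(1) l(3)[OF k]])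
  qed
  ultimately show ?thesis by blast
qed

end
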